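(* Consider the sequence of closed infinite-server systems with packing constraints described in the context, indexed by $r$, operating under the Greedy-D discipline with parameter $\alpha>0$. For each $r$ let $x^r(\infty)$ denote the random state of the fluid-scaled process $x^r(\cdot)=X^r(\cdot)/r$ in a stationary regime (i.e. a random vector whose law is a stationary distribution of $x^r(\cdot)$). Then, as $r\to\infty$, $$x^r(\infty)\Longrightarrow x^*$$ (convergence in distribution), where $x^*$ is the unique minimizer of $F(x)=\sum_{k\in\mathcal K}(1+\alpha)^{-1}x_k^{1+\alpha}$ over the polyhedron $\mathcal X=\{x\in\mathbb R^{|\mathcal K|}: x_k\ge 0\ \forall k\in\mathcal K,\ \sum_{k\in\mathcal K}k_ix_k=\rho_i\ \forall i\in\mathcal I\}$.
   Context: Configurations. $\mathcal I=\{1,\dots,I\}$ is the set of customer types. $\bar{\mathcal K}$ is a finite set of vectors $k=(k_i)_{i\in\mathcal I}$ with non-negative integer components (server configurations), such that $k\in\bar{\mathcal K}$ and $0\le k'\le k$ (componentwise, $k'$ integer) imply $k'\in\bar{\mathcal K}$; each unit vector $e_i\in\bar{\mathcal K}$; $0\in\bar{\mathcal K}$. $\mathcal K=\bar{\mathcal K}\setminus\{0\}$. There are infinitely many servers; a server in configuration $k$ is serving $k_i$ customers of type $i$ for each $i$. $X_k$ is the number of servers in configuration $k\in\mathcal K$, and $X=\{X_k,\ k\in\mathcal K\}$ is the system state. Parameters. $\lambda_i>0$, $\mu_i>0$, $\rho_i=\lambda_i/\mu_i$, with $\sum_i\rho_i=1$. The scaling parameter $r\ge1$ increases to infinity along a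 discrete sequence. Closed system with parameter $r$. There is a fixed number $\rho_i r$ of type $i$ customers (assumed integer), so $\sum_{k}k_iX^r_k(t)=\rho_i r$ for all $t$; there are no exogenous arrivals. Every type $i$ customer in service completes service at rate $\mu_i$ (exponential service times with mean $1/\mu_i$, independent across customers and unaffected by other customers in the same server). When a type $i$ customer completes service in a server of configuration $k$, that server's configuration becomes $k-e_i$ and the customer is immediately placed into a server for a new (independent) service, the server being chosen by the discipline. $X^r(\cdot)$ is a finite-state continuous-time Markov chain. Greedy-D discipline with parameter $\alpha>0$. A type $i$ customer to be placed at time $t$ is added to a server in an available configuration $k\in\bar{\mathcal K}$ (that is, $k=0$ or $X_k(t-)>0$) such that $k+e_i\in\mathcal K$ and the difference $X_{k+e_i}(t-)^{\alpha}-I\{k\ne0\}X_k(t-)^{\alpha}$ is smallest, where $X(t-)$ is the state after the service completion but before the placement. Ties are broken by an arbitrary deterministic rule. *)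

theory Defs
  imports "HOL-Probability.Probability"
begin

text \<open>Customer types are the elements of a finite type \<open>'i\<close>. A configuration \<open>k\<close> has
  \<open>k i\<close> customers of type \<open>i\<close>; the empty configuration is \<open>\<lambda>_. 0\<close>. The configuration
  \<open>k + e\<^sub>i\<close> is written \<open>k(i := Suc (k i))\<close>.\<close>

type_synonym 'i config = "'i \<Rightarrow> nat"

definition unit_config :: "'i \<Rightarrow> 'i config" where
  "unit_config i = (\<lambda>_. 0)(i := 1)"

definition config_set :: "('i::finite) config set \<Rightarrow> bool" where
  "config_set Kbar \<longleftrightarrow>
     finite Kbar \<and> (\<lambda>_. 0) \<in> Kbar \<and> (\<forall>i. unit_config i \<in> Kbar) \<and>
     (\<forall>k\<in>Kbar. \<forall>k'. k' \<le> k \<longrightarrow> k' \<in> Kbar)"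

definition nonempty_configs :: "'i config set \<Rightarrow> 'i config set" where
  "nonempty_configs Kbar = Kbar - {\<lambda>_. 0}"

text \<open>A vector indexed by the nonempty configurations is represented by a function on all
  configurations that vanishes elsewhere; in particular the (infinitely many) empty servers
  are not counted, so a state is \<open>0\<close> at the empty configuration.\<close>

type_synonym 'i state = "'i config \<Rightarrow> nat"

definition closed_states ::
  "('i::finite) config set \<Rightarrow> ('i \<Rightarrow> real) \<Rightarrow> real \<Rightarrow> 'i state set" where
  "closed_states Kbar \<rho> r =
     {X. (\<forall>k. k \<notin> nonempty_configs Kbar \<longrightarrow> X k = 0) \<and>
         (\<forall>i. (\<Sum>k\<in>nonempty_configs Kbar. real (k i) * real (X k)) = \<rho> i * r)}"

definition available ::
  "'i config set \<Rightarrow> 'i state \<Rightarrow> 'i \<Rightarrow> 'i config set" where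
  "available Kbar X i =
     {k \<in> Kbar. (k = (\<lambda>_. 0) \<or> X k > 0) \<and> k(i := Suc (k i)) \<in> nonempty_configs Kbar}"

definition greedy_increment :: "real \<Rightarrow> 'i state \<Rightarrow> 'i \<Rightarrow> 'i config \<Rightarrow> real" where
  "greedy_increment \<alpha> X i k =
     real (X (k(i := Suc (k i)))) powr \<alpha> - (if k \<noteq> (\<lambda>_. 0) then real (X k) powr \<alpha> else 0)"

text \<open>A deterministic placement rule maps the state just before the placement and the type of
  the customer to the configuration of the server that receives the customer. It is a Greedy-D
  rule if it always selects a minimizer; its choice among several minimizers is the tie-breaking.\<close>

definition greedy_rule ::
  "'i config set \<Rightarrow> real \<Rightarrow> ('i state \<Rightarrow> 'i \<Rightarrow> 'i config) \<Rightarrow> bool" where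
  "greedy_rule Kbar \<alpha> \<sigma> \<longleftrightarrow>
     (\<forall>X i. is_arg_min (greedy_increment \<alpha> X i) (\<lambda>k. k \<in> available Kbar X i) (\<sigma> X i))"

text \<open>Empty servers are not counted in a state, hence the case distinctions.\<close>

definition add_server :: "'i config \<Rightarrow> 'i state \<Rightarrow> 'i state" where
  "add_server k X = (if k = (\<lambda>_. 0) then X else X(k := X k + 1))"

definition remove_server :: "'i config \<Rightarrow> 'i state \<Rightarrow> 'i state" where
  "remove_server k X = (if k = (\<lambda>_. 0) then X else X(k := X k - 1))"

definition complete_service :: "'i config \<Rightarrow> 'i \<Rightarrow> 'i state \<Rightarrow> 'i state" where
  "complete_service k i X = add_server (k(i := k i - 1)) (remove_server k X)"

definition place_customer :: "'i config \<Rightarrow> 'i \<Rightarrow> 'i state \<Rightarrow> 'i state" where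
  "place_customer k i X = add_server (k(i := Suc (k i))) (remove_server k X)"

definition next_state ::
  "('i state \<Rightarrow> 'i \<Rightarrow> 'i config) \<Rightarrow> 'i config \<Rightarrow> 'i \<Rightarrow> 'i state \<Rightarrow> 'i state" where
  "next_state \<sigma> k i X =
     (let Y = complete_service k i X in place_customer (\<sigma> Y i) i Y)"

text \<open>In state \<open>X\<close> there are \<open>k i * X k\<close> customers of type \<open>i\<close> in servers of configuration \<open>k\<close>,
  and each of them completes service at rate \<open>\<mu> i\<close>.\<close>

definition jump_rate ::
  "('i::finite) config set \<Rightarrow> ('i \<Rightarrow> real) \<Rightarrow> ('i state \<Rightarrow> 'i \<Rightarrow> 'i config)
    \<Rightarrow> 'i state \<Rightarrow> 'i state \<Rightarrow> real" where
  "jump_rate Kbar \<mu> \<sigma> X Y =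
     (\<Sum>k\<in>nonempty_configs Kbar. \<Sum>i\<in>UNIV.
        if next_state \<sigma> k i X = Y then \<mu> i * real (k i) * real (X k) else 0)"

definition generator :: "'s set \<Rightarrow> ('s \<Rightarrow> 's \<Rightarrow> real) \<Rightarrow> 's \<Rightarrow> 's \<Rightarrow> real" where
  "generator S q x y = (if x = y then - (\<Sum>z\<in>S - {x}. q x z) else q x y)"

fun kernel_power :: "'s set \<Rightarrow> ('s \<Rightarrow> 's \<Rightarrow> real) \<Rightarrow> nat \<Rightarrow> 's \<Rightarrow> 's \<Rightarrow> real" where
  "kernel_power S Q 0 x y = (if x = y then 1 else 0)"
| "kernel_power S Q (Suc n) x y = (\<Sum>z\<in>S. Q x z * kernel_power S Q n z y)"

text \<open>The transition function \<open>P\<^sub>t = exp (t Q)\<close> of the Markov chain with finite state space \<open>S\<close>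
  and jump rates \<open>q\<close>, where \<open>Q\<close> is the generator.\<close>

definition transition_function ::
  "'s set \<Rightarrow> ('s \<Rightarrow> 's \<Rightarrow> real) \<Rightarrow> real \<Rightarrow> 's \<Rightarrow> 's \<Rightarrow> real" where
  "transition_function S q t x y =
     (\<Sum>n. t ^ n / fact n * kernel_power S (generator S q) n x y)"

definition stationary_distribution ::
  "'s set \<Rightarrow> ('s \<Rightarrow> 's \<Rightarrow> real) \<Rightarrow> 's measure \<Rightarrow> bool" where
  "stationary_distribution S q N \<longleftrightarrow>
     prob_space N \<and> sets N = sets (count_space S) \<and>
     (\<forall>t\<ge>0. \<forall>y\<in>S. (\<Sum>x\<in>S. measure N {x} * transition_function S q t x y) = measure N {y})"

definition fluid_scaled :: "real \<Rightarrow> 'i state \<Rightarrow> 'i config \<Rightarrow> real" where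
  "fluid_scaled r X = (\<lambda>k. real (X k) / r)"

definition fluid_polyhedron ::
  "('i::finite) config set \<Rightarrow> ('i \<Rightarrow> real) \<Rightarrow> ('i config \<Rightarrow> real) set" where
  "fluid_polyhedron Kbar \<rho> =
     {x. (\<forall>k. k \<notin> nonempty_configs Kbar \<longrightarrow> x k = 0) \<and>
         (\<forall>k\<in>nonempty_configs Kbar. x k \<ge> 0) \<and>
         (\<forall>i. (\<Sum>k\<in>nonempty_configs Kbar. real (k i) * x k) = \<rho> i)}"

definition fluid_objective ::
  "'i config set \<Rightarrow> real \<Rightarrow> ('i config \<Rightarrow> real) \<Rightarrow> real" where
  "fluid_objective Kbar \<alpha> x =
     (\<Sum>k\<in>nonempty_configs Kbar. inverse (1 + \<alpha>) * x k powr (1 + \<alpha>))"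

text \<open>This is used with the product topology on functions from configurations to reals. As all
  vectors in question vanish outside a fixed finite set of coordinates, convergence in distribution is
  the usual one in a finite-dimensional Euclidean space.\<close>

definition converges_in_distribution ::
  "(nat \<Rightarrow> ('a::topological_space) measure) \<Rightarrow> 'a measure \<Rightarrow> bool" where
  "converges_in_distribution M N \<longleftrightarrow>
     (\<forall>f::'a \<Rightarrow> real. continuous_on UNIV f \<longrightarrow> bounded (range f) \<longrightarrow>
        (\<lambda>n. integral\<^sup>L (M n) f) \<longlonglongrightarrow> integral\<^sup>L N f)"

end

theory Submission
  imports Defs
begin

text \<open>The Lyapunov function is a discretisation of \<open>F\<close>. A customer who completes service could be put
  back into the server just vacated, so a greedy placement never increases it beyond a
  discretisation error of order \<open>o(r powr \<alpha>)\<close>. As the stationary drift vanishes, the expected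
  rate of decrease (\<open>dissipation\<close>), divided by \<open>r powr (1 + \<alpha>)\<close>, tends to \<open>0\<close>.

  Let \<open>x\<close> be a limit point of scaled states whose scaled dissipation tends to \<open>0\<close>, and let \<open>\<eta> i\<close>
  be the least of the increments \<open>x (l + e i) powr \<alpha> - x l powr \<alpha>\<close> over empty or occupied
  \<open>l\<close>. Every occupied \<open>k\<close> with \<open>k i > 0\<close> satisfies
  \<open>x k powr \<alpha> - x (k - e i) powr \<alpha> \<le> \<eta> i\<close>, and it follows that
  \<open>x k powr \<alpha> = max 0 (\<Sum>i. \<eta> i * k i)\<close> for all \<open>k\<close>. These are the optimality conditions of
  the strictly convex problem, so \<open>x\<close> is its unique minimizer. By compactness, states away from the
  minimizer have dissipation bounded below, and Markov's inequality concludes.\<close>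

subsection \<open>Analytic preliminaries\<close>

text \<open>Strict convexity of the primitive of \<open>t powr \<alpha>\<close>: by the mean value
  theorem the secant slope is the derivative at an interior point, and that derivative is strictly
  increasing. At the endpoints, one of which may be \<open>0\<close>, only continuity is
  used.\<close>

lemma powr_tangent_less:
  fixes x y \<alpha> :: real
  assumes "0 < \<alpha>" "0 \<le> x" "0 \<le> y" "x \<noteq> y"
  shows "x powr \<alpha> * (y - x) < inverse (1 + \<alpha>) * y powr (1 + \<alpha>) - inverse (1 + \<alpha>) * x powr (1 + \<alpha>)"
proof -
  let ?f = "\<lambda>t::real. inverse (1 + \<alpha>) * t powr (1 + \<alpha>)"
  have mvt: "\<exists>z. a < z \<and> z < b \<and> ?f b - ?f a = (b - a) * z powr \<alpha>" if "0 \<le> a" "a < b" for a b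
  proof -
    have der: "(?f has_real_derivative z powr \<alpha>) (at z)" if "0 < z" for z
    proof -
      have "(?f has_real_derivative inverse (1 + \<alpha>) * ((1 + \<alpha>) * z powr (1 + \<alpha> - 1))) (at z)"
        using that by (intro DERIV_cmult has_real_derivative_powr)
      moreover have "inverse (1 + \<alpha>) * ((1 + \<alpha>) * z powr (1 + \<alpha> - 1)) = z powr \<alpha>"
        using \<open>0 < \<alpha>\<close> by (simp add: field_simps)
      ultimately show ?thesis by metis
    qed
    have "continuous_on {a..b} ?f"
      using that \<open>0 < \<alpha>\<close> by (intro continuous_on_mult continuous_on_powr' continuous_intros) auto
    moreover have "?f differentiable (at z)" if "a < z" "z < b" for z
      using der[of z] that \<open>0 \<le> a\<close> real_differentiable_def by force
    ultimately obtain l z where z: "a < z" "z < b" "DERIV ?f z :> l" "?f b - ?f a = (b - a) * l"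
      using MVT[OF \<open>a < b\<close>, of ?f] by blast
    then have "l = z powr \<alpha>"
      using der[of z] \<open>0 \<le> a\<close> DERIV_unique by force
    with z show ?thesis by blast
  qed
  show ?thesis
  proof (cases "x < y")
    case True
    then obtain z where z: "x < z" "z < y" "?f y - ?f x = (y - x) * z powr \<alpha>"
      using mvt[of x y] assms by auto
    have "x powr \<alpha> < z powr \<alpha>"
      using z assms by (intro powr_less_mono2) auto
    then have "(y - x) * x powr \<alpha> < (y - x) * z powr \<alpha>"
      using True by simp
    with z show ?thesis by (simp add: mult.commute)
  next
    case False
    then obtain z where z: "y < z" "z < x" "?f x - ?f y = (x - y) * z powr \<alpha>"
      using mvt[of y x] assms by force
    have "z powr \<alpha> < x powr \<alpha>"
      using z assms by (intro powr_less_mono2) auto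
    then have "(x - y) * z powr \<alpha> < (x - y) * x powr \<alpha>"
      using z by simp
    with z show ?thesis by (simp add: algebra_simps)
  qed
qed

text \<open>Uniform continuity of \<open>t powr \<alpha>\<close> on \<open>[0, 2]\<close>, applied
  to \<open>m / r\<close> and \<open>(m - 1) / r\<close>; this treats \<open>\<alpha> < 1\<close>
  and \<open>\<alpha> \<ge> 1\<close> alike. The range up to \<open>2 * r\<close> leaves room for a
  count that a departure has raised from at most \<open>r\<close> to at most
  \<open>r + 1\<close>.\<close>

lemma powr_nat_increment_small:
  fixes \<alpha> \<epsilon> :: real
  assumes "0 < \<alpha>" "0 < \<epsilon>"
  obtains R where "1 \<le> R"
    "\<And>r m. R \<le> r \<Longrightarrow> 0 < m \<Longrightarrow> real m \<le> 2 * r \<Longrightarrow>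
      real m powr \<alpha> - real (m - 1) powr \<alpha> \<le> \<epsilon> * r powr \<alpha>"
proof -
  have "continuous_on {0..2::real} (\<lambda>t. t powr \<alpha>)"
    using assms by (intro continuous_on_powr' continuous_intros) auto
  then have "uniformly_continuous_on {0..2::real} (\<lambda>t. t powr \<alpha>)"
    by (intro compact_uniformly_continuous) auto
  then obtain d where d: "d > 0"
    "\<And>s t. s \<in> {0..2} \<Longrightarrow> t \<in> {0..2} \<Longrightarrow> dist t s < d \<Longrightarrow> dist (t powr \<alpha>) (s powr \<alpha>) < \<epsilon>"
    using \<open>0 < \<epsilon>\<close> unfolding uniformly_continuous_on_def by meson
  \<comment> \<open>The factor \<open>2\<close> makes \<open>1 / r < d\<close> strict for every
    \<open>r \<ge> R\<close>.\<close>
  define R where "R = max 1 (2 / d)"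
  have "real m powr \<alpha> - real (m - 1) powr \<alpha> \<le> \<epsilon> * r powr \<alpha>"
    if r: "R \<le> r" and m: "0 < m" "real m \<le> 2 * r" for r m
  proof -
    have "r > 0" "1 / r < d"
      using r d(1) unfolding R_def by (auto simp: field_simps)
    have "dist (real m / r) (real (m - 1) / r) = 1 / r"
      using m \<open>r > 0\<close> by (simp add: dist_real_def field_simps abs_if)
    then have "dist (real m / r) (real (m - 1) / r) < d"
      using \<open>1 / r < d\<close> by simp
    moreover have "real m / r \<in> {0..2}" "real (m - 1) / r \<in> {0..2}"
      using \<open>r > 0\<close> m by (auto simp: field_simps)
    ultimately have "dist ((real m / r) powr \<alpha>) ((real (m - 1) / r) powr \<alpha>) < \<epsilon>"
      using d(2) by blast
    then have "real m powr \<alpha> / r powr \<alpha> - real (m - 1) powr \<alpha> / r powr \<alpha> < \<epsilon>"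
      using \<open>r > 0\<close> by (simp add: dist_real_def powr_divide abs_if split: if_splits)
    then show ?thesis
      using \<open>r > 0\<close> by (simp add: field_simps)
  qed
  then show thesis
    using that[of R] unfolding R_def by simp
qed

lemma tendsto_fun_iff:
  fixes f :: "'c \<Rightarrow> 'a \<Rightarrow> 'b::topological_space"
  shows "(f \<longlongrightarrow> l) F \<longleftrightarrow> (\<forall>a. ((\<lambda>c. f c a) \<longlongrightarrow> l a) F)"
  using limitin_componentwise[of "\<lambda>_. euclidean" UNIV f l F]
  by (simp add: euclidean_product_topology)

text \<open>Tychonoff: the sequence lives in a product of compact intervals and singletons.
  Countability of the index type makes the product topology first countable, so compactness yields
  convergent subsequences.\<close>

lemma bounded_finite_support_subsequence:
  fixes x :: "nat \<Rightarrow> 'a::countable \<Rightarrow> real"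
  assumes "\<And>n a. a \<in> A \<Longrightarrow> \<bar>x n a\<bar> \<le> B" "\<And>n a. a \<notin> A \<Longrightarrow> x n a = 0"
  obtains l s where "strict_mono s" "(x \<circ> s) \<longlonglongrightarrow> l"
proof -
  let ?C = "PiE UNIV (\<lambda>a. if a \<in> A then {-B..B} else {0::real})"
  have "compactin (product_topology (\<lambda>_. euclidean) UNIV) ?C"
    by (subst compactin_PiE) auto
  then have "compact ?C"
    by (simp add: euclidean_product_topology)
  then have "seq_compact ?C"
    by (rule compact_imp_seq_compact)
  moreover have "\<And>n. x n \<in> ?C"
  proof -
    fix n
    have "x n a \<in> (if a \<in> A then {-B..B} else {0})" for a
      using assms(1)[of a n] assms(2)[of a n] by auto
    then show "x n \<in> ?C" by blast
  qed
  ultimately show thesis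
    using that unfolding seq_compact_def by metis
qed

subsection \<open>Optimality conditions\<close>

lemma weighted_sum_decrement:
  fixes k :: "'i::finite \<Rightarrow> nat" and \<eta> :: "'i \<Rightarrow> real"
  assumes "0 < k j"
  shows "(\<Sum>i\<in>UNIV. \<eta> i * real (k i)) = (\<Sum>i\<in>UNIV. \<eta> i * real ((k(j := k j - 1)) i)) + \<eta> j"
proof -
  have "(\<Sum>i\<in>UNIV - {j}. \<eta> i * real ((k(j := k j - 1)) i)) = (\<Sum>i\<in>UNIV - {j}. \<eta> i * real (k i))"
    by (intro sum.cong) auto
  then show ?thesis
    unfolding sum.remove[OF finite UNIV_I[of j]]
    using assms by (simp add: algebra_simps)
qed

lemma sum_decrement:
  fixes k :: "'i::finite \<Rightarrow> nat"
  assumes "0 < k j"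
  shows "(\<Sum>i\<in>UNIV. k i) = Suc (\<Sum>i\<in>UNIV. (k(j := k j - 1)) i)"
  using weighted_sum_decrement[where \<eta> = "\<lambda>_. 1" and k = k and j = j] assms
  by (simp flip: of_nat_sum of_nat_Suc del: fun_upd_apply)

text \<open>In the next two lemmas, customers of types with \<open>\<eta> \<le> 0\<close> are removed first: this keeps all
  intermediate configurations occupied, so the one-step inequalities can be summed up down to
  the empty configuration.\<close>

lemma downset_dominance:
  fixes Kbar :: "('i::finite) config set" and h :: "'i config \<Rightarrow> real" and \<eta> :: "'i \<Rightarrow> real"
  assumes K: "config_set Kbar" and k: "k \<in> Kbar" and h0: "\<And>k. 0 \<le> h k"
    and up: "\<And>k i. k(i := Suc (k i)) \<in> Kbar \<Longrightarrow> k = (\<lambda>_. 0) \<or> 0 < h k \<Longrightarrow>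
       h k + \<eta> i \<le> h (k(i := Suc (k i)))"
  shows "(\<Sum>i\<in>UNIV. \<eta> i * real (k i)) \<le> h k"
proof -
  let ?v = "\<lambda>k::'i config. \<Sum>i\<in>UNIV. \<eta> i * real (k i)"
  \<comment> \<open>Where the weight is nonpositive the claim follows from
    \<open>h k \<ge> 0\<close>. Inducting over positive weights only makes each nonempty predecessor
    occupied, as \<open>up\<close> demands.\<close>
  have "0 < ?v k \<Longrightarrow> ?v k \<le> h k"
    using k
  proof (induction "\<Sum>i\<in>UNIV. k i" arbitrary: k rule: less_induct)
    case less
    have step: "?v k \<le> h k" if j: "k j > 0" and k': "k' = k(j := k j - 1)" and pos: "?v k' > 0 \<or> k' = (\<lambda>_. 0)" for j k'
    proof -
      have kk: "k = k'(j := Suc (k' j))"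
        using j k' by auto
      have sz: "(\<Sum>i\<in>UNIV. k i) = Suc (\<Sum>i\<in>UNIV. k' i)"
        unfolding k' using sum_decrement[of k j] j by simp
      have v: "?v k = ?v k' + \<eta> j"
        unfolding k' using weighted_sum_decrement[of k j \<eta>] j by simp
      have mem: "k' \<in> Kbar"
        using K less.prems(2) k' unfolding config_set_def by (auto simp: le_fun_def)
      have "?v k' \<le> h k' \<and> (k' = (\<lambda>_. 0) \<or> 0 < h k')"
      proof (cases "k' = (\<lambda>_. 0)")
        case False
        with pos have "?v k' > 0" by simp
        with less.hyps[of k'] mem sz show ?thesis by auto
      qed (use h0 in auto)
      with up[of k' j] kk less.prems(2) v show ?thesis by auto
    qed
    show ?case
    proof (cases "\<exists>j. k j > 0 \<and> \<eta> j \<le> 0")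
      case True
      then obtain j where j: "k j > 0" "\<eta> j \<le> 0" by blast
      have "?v k = ?v (k(j := k j - 1)) + \<eta> j"
        using weighted_sum_decrement[of k j \<eta>] j by simp
      with j less.prems(1) have "?v (k(j := k j - 1)) > 0" by linarith
      with step[OF j(1) refl] show ?thesis by blast
    next
      case False
      have "k \<noteq> (\<lambda>_. 0)" using less.prems(1) by auto
      then obtain j where j: "k j > 0" by auto
      let ?k = "k(j := k j - 1)"
      \<comment> \<open>Every type still present has positive weight, so a nonempty remainder has
        positive weight whichever type is removed.\<close>
      have nn: "\<eta> i > 0" if "k i > 0" for i
        using False that by (meson not_le)
      have "?v ?k > 0" if nz: "?k \<noteq> (\<lambda>_. 0)"
      proof -
        obtain i where i: "?k i > 0" using nz by (auto simp: fun_eq_iff)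
        have ge: "\<eta> i * real (?k i) \<ge> 0" for i
          using nn[of i] j by (cases "k i > 0") (auto simp: less_imp_le)
        have "\<eta> i * real (?k i) > 0"
          using i nn[of i] by (auto split: if_splits)
        then show ?thesis
          by (intro sum_pos2[of _ i]) (use ge in auto)
      qed
      with step[OF j refl] show ?thesis by blast
    qed
  qed
  then show ?thesis
    using h0[of k] by linarith
qed

lemma downset_complementary_slackness:
  fixes Kbar :: "('i::finite) config set" and h :: "'i config \<Rightarrow> real" and \<eta> :: "'i \<Rightarrow> real"
  assumes K: "config_set Kbar" and k: "k \<in> Kbar" and h0: "\<And>k. 0 \<le> h k" and hz: "h (\<lambda>_. 0) = 0"
    and up: "\<And>k i. k(i := Suc (k i)) \<in> Kbar \<Longrightarrow> k = (\<lambda>_. 0) \<or> 0 < h k \<Longrightarrow>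
       h k + \<eta> i \<le> h (k(i := Suc (k i)))"
    and down: "\<And>k i. k \<in> Kbar \<Longrightarrow> 0 < k i \<Longrightarrow> 0 < h k \<Longrightarrow> h k \<le> h (k(i := k i - 1)) + \<eta> i"
    and pos: "0 < h k"
  shows "h k = (\<Sum>i\<in>UNIV. \<eta> i * real (k i))"
proof -
  let ?v = "\<lambda>k::'i config. \<Sum>i\<in>UNIV. \<eta> i * real (k i)"
  \<comment> \<open>Dominance is one half of the equality; in the induction it also shows that a
    remainder of positive weight is occupied.\<close>
  have lower: "?v k \<le> h k" if "k \<in> Kbar" for k
    using downset_dominance[of Kbar k h \<eta>] K that h0 up by blast
  have "h k \<le> ?v k"
    using k pos
  proof (induction "\<Sum>i\<in>UNIV. k i" arbitrary: k rule: less_induct)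
    case less
    have step: "h k \<le> ?v k" if j: "k j > 0" and k': "k' = k(j := k j - 1)" and pos: "h k' > 0 \<or> k' = (\<lambda>_. 0)" for j k'
    proof -
      have sz: "(\<Sum>i\<in>UNIV. k i) = Suc (\<Sum>i\<in>UNIV. k' i)"
        unfolding k' using sum_decrement[of k j] j by simp
      have v: "?v k = ?v k' + \<eta> j"
        unfolding k' using weighted_sum_decrement[of k j \<eta>] j by simp
      have mem: "k' \<in> Kbar"
        using K less.prems(1) k' unfolding config_set_def by (auto simp: le_fun_def)
      have "h k' \<le> ?v k'"
        using less.hyps[of k'] mem sz pos hz by auto
      with down[of k j] j less.prems v k' show ?thesis by auto
    qed
    show ?case
    proof (cases "\<exists>j. k j > 0 \<and> \<eta> j \<le> 0")
      case True
      then obtain j where j: "k j > 0" "\<eta> j \<le> 0" by blast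
      \<comment> \<open>By \<open>down\<close>, removing a type with \<open>\<eta> j \<le> 0\<close>
        cannot lower \<open>h\<close>.\<close>
      with down[of k j] less.prems have "h (k(j := k j - 1)) > 0" by auto
      with step[OF j(1) refl] show ?thesis by blast
    next
      case False
      have "k \<noteq> (\<lambda>_. 0)" using less.prems hz by auto
      then obtain j where j: "k j > 0" by auto
      let ?k = "k(j := k j - 1)"
      have nn: "\<eta> i > 0" if "k i > 0" for i
        using False that by (meson not_le)
      have mem: "?k \<in> Kbar"
        using K less.prems(1) unfolding config_set_def by (auto simp: le_fun_def)
      have "h ?k > 0" if nz: "?k \<noteq> (\<lambda>_. 0)"
      proof -
        obtain i where i: "?k i > 0" using nz by (auto simp: fun_eq_iff)
        have ge: "\<eta> i * real (?k i) \<ge> 0" for i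
          using nn[of i] j by (cases "k i > 0") (auto simp: less_imp_le)
        have "\<eta> i * real (?k i) > 0"
          using i nn[of i] by (auto split: if_splits)
        then have "?v ?k > 0"
          by (intro sum_pos2[of _ i]) (use ge in auto)
        with lower[OF mem] show ?thesis by linarith
      qed
      with step[OF j refl] show ?thesis by blast
    qed
  qed
  with lower[OF k] show ?thesis by simp
qed

text \<open>Sufficiency of the Karush-Kuhn-Tucker conditions, with \<open>\<eta>\<close> as
  multipliers of the customer constraints: \<open>dom\<close> is dual feasibility and
  \<open>slack\<close> complementary slackness. The linear form given by \<open>\<eta>\<close>
  agrees on \<open>x\<close> and \<open>y\<close>, and strict convexity gives the strict
  inequality.\<close>

lemma fluid_objective_less:
  fixes Kbar :: "('i::finite) config set"
  assumes K: "config_set Kbar" and \<alpha>: "0 < \<alpha>"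
    and x: "x \<in> fluid_polyhedron Kbar \<rho>" and y: "y \<in> fluid_polyhedron Kbar \<rho>" and "y \<noteq> x"
    and dom: "\<And>k. k \<in> Kbar \<Longrightarrow> (\<Sum>i\<in>UNIV. \<eta> i * real (k i)) \<le> x k powr \<alpha>"
    and slack: "\<And>k. k \<in> Kbar \<Longrightarrow> 0 < x k \<Longrightarrow> x k powr \<alpha> = (\<Sum>i\<in>UNIV. \<eta> i * real (k i))"
  shows "fluid_objective Kbar \<alpha> x < fluid_objective Kbar \<alpha> y"
proof -
  let ?K = "nonempty_configs Kbar"
  let ?v = "\<lambda>k::'i config. \<Sum>i\<in>UNIV. \<eta> i * real (k i)"
  have fin: "finite ?K" and sub: "?K \<subseteq> Kbar"
    using K unfolding config_set_def nonempty_configs_def by auto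
  have nn: "0 \<le> x k" "0 \<le> y k" if "k \<in> ?K" for k
    using x y that unfolding fluid_polyhedron_def by auto
  obtain k0 where k0: "k0 \<in> ?K" "x k0 \<noteq> y k0"
  proof -
    obtain k where k: "y k \<noteq> x k"
      using \<open>y \<noteq> x\<close> by blast
    moreover have "k \<in> ?K"
      using x y k unfolding fluid_polyhedron_def by (smt (verit) mem_Collect_eq)
    ultimately show thesis
      using that by metis
  qed
  have "(\<Sum>k\<in>?K. ?v k * (y k - x k)) = (\<Sum>k\<in>?K. \<Sum>i\<in>UNIV. \<eta> i * (real (k i) * y k) - \<eta> i * (real (k i) * x k))"
    unfolding sum_distrib_right by (intro sum.cong) (simp_all add: algebra_simps)
  also have "\<dots> = (\<Sum>i\<in>UNIV. \<Sum>k\<in>?K. \<eta> i * (real (k i) * y k) - \<eta> i * (real (k i) * x k))"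
    by (rule sum.swap)
  also have "\<dots> = (\<Sum>i\<in>UNIV. \<eta> i * (\<Sum>k\<in>?K. real (k i) * y k) - \<eta> i * (\<Sum>k\<in>?K. real (k i) * x k))"
    by (simp add: sum_distrib_left sum_subtractf)
  also have "\<dots> = 0"
    using x y unfolding fluid_polyhedron_def by simp
  finally have "0 = (\<Sum>k\<in>?K. ?v k * (y k - x k))" by simp
  \<comment> \<open>Terms with \<open>x k > 0\<close> are equal by slackness; where
    \<open>x k = 0\<close>, the factor \<open>y k - x k\<close> is nonnegative and dominance
    suffices.\<close>
  also have "\<dots> \<le> (\<Sum>k\<in>?K. x k powr \<alpha> * (y k - x k))"
  proof (rule sum_mono)
    fix k assume k: "k \<in> ?K"
    show "?v k * (y k - x k) \<le> x k powr \<alpha> * (y k - x k)"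
    proof (cases "0 < x k")
      case True
      then show ?thesis using slack[of k] k sub by auto
    next
      case False
      then have "x k = 0" using nn[OF k] by simp
      then show ?thesis using dom[of k] k sub nn[OF k] by (intro mult_right_mono) auto
    qed
  qed
  also have "\<dots> < (\<Sum>k\<in>?K. inverse (1 + \<alpha>) * y k powr (1 + \<alpha>) - inverse (1 + \<alpha>) * x k powr (1 + \<alpha>))"
  proof (rule sum_strict_mono_ex1[OF fin])
    show "\<forall>k\<in>?K. x k powr \<alpha> * (y k - x k) \<le> inverse (1 + \<alpha>) * y k powr (1 + \<alpha>) - inverse (1 + \<alpha>) * x k powr (1 + \<alpha>)"
      using powr_tangent_less[OF \<alpha>] nn
      by (metis (no_types, lifting) diff_self less_imp_le mult_zero_right order_refl)
    show "\<exists>k\<in>?K. x k powr \<alpha> * (y k - x k) < inverse (1 + \<alpha>) * y k powr (1 + \<alpha>) - inverse (1 + \<alpha>) * x k powr (1 + \<alpha>)"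
      using powr_tangent_less[OF \<alpha> nn[OF k0(1)] k0(2)] k0 by blast
  qed
  finally show ?thesis
    unfolding fluid_objective_def by (simp add: sum_subtractf)
qed

subsection \<open>State transitions\<close>

lemma finite_nonempty_configs: "config_set Kbar \<Longrightarrow> finite (nonempty_configs Kbar)"
  unfolding config_set_def nonempty_configs_def by auto

lemma config_set_decrement:
  fixes Kbar :: "('i::finite) config set"
  assumes "config_set Kbar" "k \<in> Kbar"
  shows "k(i := k i - 1) \<in> Kbar"
  using assms unfolding config_set_def by (auto simp: le_fun_def)

lemma sum_fun_upd:
  fixes \<phi> :: "'a \<Rightarrow> 'b \<Rightarrow> real"
  assumes "finite A" "a \<in> A"
  shows "(\<Sum>x\<in>A. \<phi> x ((X(a := v)) x)) = (\<Sum>x\<in>A. \<phi> x (X x)) + \<phi> a v - \<phi> a (X a)"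
proof -
  have "(\<Sum>x\<in>A - {a}. \<phi> x ((X(a := v)) x)) = (\<Sum>x\<in>A - {a}. \<phi> x (X x))"
    by (intro sum.cong) auto
  then show ?thesis
    using assms by (simp add: sum.remove[of A a])
qed

lemma place_customer_eq:
  "place_customer l i Y =
     (if l = (\<lambda>_. 0) then Y else Y(l := Y l - 1))(l(i := Suc (l i)) := Suc (Y (l(i := Suc (l i)))))"
proof -
  have "l(i := Suc (l i)) \<noteq> l" "l(i := Suc (l i)) \<noteq> (\<lambda>_. 0)"
    by (auto simp: fun_eq_iff split: if_splits)
  then show ?thesis
    unfolding place_customer_def add_server_def remove_server_def by auto
qed

text \<open>Serves both the conservation of customer numbers and the change of the Lyapunov
  function: a placement moves only the coordinates \<open>l'\<close> and, if it is counted,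
  \<open>l\<close>.\<close>

lemma sum_place_customer:
  fixes \<phi> :: "'i::finite config \<Rightarrow> nat \<Rightarrow> real"
  assumes K: "config_set Kbar" and l: "l \<in> Kbar" "l' = l(i := Suc (l i))" "l' \<in> Kbar"
  shows "(\<Sum>k\<in>nonempty_configs Kbar. \<phi> k (place_customer l i Y k)) =
    (\<Sum>k\<in>nonempty_configs Kbar. \<phi> k (Y k)) + (\<phi> l' (Suc (Y l')) - \<phi> l' (Y l'))
      - (if l \<noteq> (\<lambda>_. 0) then \<phi> l (Y l) - \<phi> l (Y l - 1) else 0)"
proof -
  let ?K = "nonempty_configs Kbar"
  have ne: "l' \<noteq> l" "l' \<noteq> (\<lambda>_. 0)"
    using l(2) by (auto simp: fun_eq_iff split: if_splits)
  have mem: "l' \<in> ?K" "l \<noteq> (\<lambda>_. 0) \<Longrightarrow> l \<in> ?K"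
    using l ne unfolding nonempty_configs_def by auto
  note fin = finite_nonempty_configs[OF K]
  show ?thesis
    unfolding place_customer_eq l(2)[symmetric] sum_fun_upd[OF fin mem(1)]
    using sum_fun_upd[OF fin mem(2), of \<phi> Y "Y l - 1"] ne by (cases "l = (\<lambda>_. 0)") simp_all
qed

text \<open>Undoing a departure. It exhibits the state before the departure as a placement into the
  same intermediate state from which the greedy rule starts. The assumption \<open>0 < X k\<close>
  guards against truncated subtraction.\<close>

lemma place_complete_service:
  assumes "0 < k i" "0 < X k"
  shows "place_customer (k(i := k i - 1)) i (complete_service k i X) = X"
proof -
  define k' where "k' = k(i := k i - 1)"
  have k': "k'(i := Suc (k' i)) = k" "k' \<noteq> k" "k \<noteq> (\<lambda>_. 0)"
    using assms unfolding k'_def by (auto simp: fun_eq_iff split: if_splits)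
  have "place_customer k' i (add_server k' (remove_server k X)) = X"
    unfolding place_customer_def k'(1) using k'(2,3) assms(2)
    by (cases "k' = (\<lambda>_. 0)") (auto simp: add_server_def remove_server_def)
  then show ?thesis
    unfolding complete_service_def k'_def .
qed

lemma complete_service_le: "complete_service k i X l \<le> Suc (X l)"
  unfolding complete_service_def add_server_def remove_server_def by auto

lemma complete_service_ge: "X l \<le> Suc (complete_service k i X l)"
  unfolding complete_service_def add_server_def remove_server_def by auto

lemma complete_service_outside:
  assumes "config_set Kbar" "k \<in> Kbar" "l \<notin> nonempty_configs Kbar" "X l = 0"
  shows "complete_service k i X l = 0"
proof -
  have "add_server k' (remove_server k X) l = 0" if "k' \<in> Kbar" for k'
  proof -
    have "l \<noteq> m" if "m \<in> Kbar" "m \<noteq> (\<lambda>_. 0)" for m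
      using assms(3) that unfolding nonempty_configs_def by blast
    then show ?thesis
      using assms(2,4) that unfolding add_server_def remove_server_def by simp
  qed
  then show ?thesis
    unfolding complete_service_def
    using config_set_decrement[where k = k and i = i, OF assms(1,2)] by blast
qed

lemma place_customer_outside:
  assumes "l(i := Suc (l i)) \<in> nonempty_configs Kbar" "k \<notin> nonempty_configs Kbar" "Y k = 0"
  shows "place_customer l i Y k = 0"
  using assms unfolding place_customer_eq by auto

lemma greedy_rule_available: "greedy_rule Kbar \<alpha> \<sigma> \<Longrightarrow> \<sigma> Y i \<in> available Kbar Y i"
  unfolding greedy_rule_def is_arg_min_def by blast

lemma greedy_rule_le:
  "greedy_rule Kbar \<alpha> \<sigma> \<Longrightarrow> l \<in> available Kbar Y i \<Longrightarrow>
     greedy_increment \<alpha> Y i (\<sigma> Y i) \<le> greedy_increment \<alpha> Y i l"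
  unfolding greedy_rule_def is_arg_min_def by (meson not_less)

text \<open>Either the customer leaves an empty server behind, which is always available, or the
  completion has just incremented the count of the remaining configuration.\<close>

lemma vacated_available:
  assumes K: "config_set Kbar" and k: "k \<in> Kbar" and pos: "0 < k i"
  shows "k(i := k i - 1) \<in> available Kbar (complete_service k i X) i"
proof -
  have "(k(i := k i - 1))(i := Suc ((k(i := k i - 1)) i)) = k"
    using pos by auto
  moreover have "k \<noteq> (\<lambda>_. 0)"
    using pos by auto
  ultimately show ?thesis
    using k config_set_decrement[where k = k and i = i, OF K k]
    unfolding available_def nonempty_configs_def complete_service_def add_server_def by simp
qed

text \<open>A nonempty configuration contains some type \<open>i\<close>, so its \<open>X k\<close>
  servers hold at least \<open>X k\<close> of the \<open>\<rho> i * r \<le> r\<close> customers of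
  that type.\<close>

lemma closed_states_le:
  assumes K: "config_set Kbar" and \<rho>: "\<And>i. \<rho> i \<le> 1" and r: "0 \<le> r"
    and X: "X \<in> closed_states Kbar \<rho> r"
  shows "real (X k) \<le> r"
proof (cases "k \<in> nonempty_configs Kbar")
  case True
  then obtain i where i: "k i > 0"
    unfolding nonempty_configs_def by auto
  have "real (X k) \<le> real (k i) * real (X k)"
    using i by (simp add: Suc_leI flip: of_nat_mult)
  also have "\<dots> \<le> (\<Sum>k\<in>nonempty_configs Kbar. real (k i) * real (X k))"
    using finite_nonempty_configs[OF K] True by (intro member_le_sum) auto
  also have "\<dots> = \<rho> i * r"
    using X unfolding closed_states_def by auto
  also have "\<dots> \<le> 1 * r"
    using \<rho> r by (intro mult_right_mono)
  finally show ?thesis by simp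
qed (use X r in \<open>auto simp: closed_states_def\<close>)

lemma finite_closed_states:
  assumes K: "config_set Kbar" and \<rho>: "\<And>i. \<rho> i \<le> 1" and r: "0 \<le> r"
  shows "finite (closed_states Kbar \<rho> r)"
proof (rule finite_subset)
  show "closed_states Kbar \<rho> r \<subseteq>
    {X. \<forall>k. (k \<in> nonempty_configs Kbar \<longrightarrow> X k \<in> {..nat \<lfloor>r\<rfloor>}) \<and> (k \<notin> nonempty_configs Kbar \<longrightarrow> X k = 0)}"
  proof safe
    fix X k assume X: "X \<in> closed_states Kbar \<rho> r"
    show "X k \<le> nat \<lfloor>r\<rfloor>"
      using closed_states_le[OF K \<rho> r X] by (simp add: le_nat_floor)
    show "k \<notin> nonempty_configs Kbar \<Longrightarrow> X k = 0"
      using X unfolding closed_states_def by auto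
  qed
  show "finite {X. \<forall>k. (k \<in> nonempty_configs Kbar \<longrightarrow> X k \<in> {..nat \<lfloor>r\<rfloor>}) \<and> (k \<notin> nonempty_configs Kbar \<longrightarrow> X k = 0)}"
    by (intro finite_set_of_finite_funs finite_nonempty_configs[OF K]) auto
qed

text \<open>The old and the new state both arise by placing a type \<open>i\<close> customer into
  the same intermediate state, and a placement raises the type \<open>i\<close> count by one
  whichever server is chosen.\<close>

lemma next_state_closed:
  assumes K: "config_set Kbar" and \<sigma>: "greedy_rule Kbar \<alpha> \<sigma>"
    and X: "X \<in> closed_states Kbar \<rho> r" and k: "k \<in> Kbar" "0 < k i" "0 < X k"
  shows "next_state \<sigma> k i X \<in> closed_states Kbar \<rho> r"
proof -
  define Y where "Y = complete_service k i X"
  define l where "l = \<sigma> Y i"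
  let ?K = "nonempty_configs Kbar"
  let ?k = "k(i := k i - 1)"
  have l: "l \<in> Kbar" "l(i := Suc (l i)) \<in> ?K" "l \<noteq> (\<lambda>_. 0) \<Longrightarrow> 0 < Y l"
    using greedy_rule_available[OF \<sigma>, of Y i] unfolding available_def l_def by auto
  have v: "?k \<in> Kbar" "?k(i := Suc (?k i)) \<in> ?K" "?k \<noteq> (\<lambda>_. 0) \<Longrightarrow> 0 < Y ?k"
    using vacated_available[where k = k and i = i and X = X, OF K k(1,2)] unfolding available_def Y_def by auto
  have cust: "(\<Sum>k\<in>?K. real (k j) * real (place_customer m i Y k)) =
      (\<Sum>k\<in>?K. real (k j) * real (Y k)) + (if j = i then 1 else 0)"
    if m: "m \<in> Kbar" "m(i := Suc (m i)) \<in> ?K" "m \<noteq> (\<lambda>_. 0) \<Longrightarrow> 0 < Y m" for m j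
  proof -
    have "m(i := Suc (m i)) \<in> Kbar" using m unfolding nonempty_configs_def by auto
    from sum_place_customer[OF K m(1) refl this, of "\<lambda>k n. real (k j) * real n" Y]
    show ?thesis
      using m(3) by (cases "m = (\<lambda>_. 0)") (auto simp: algebra_simps)
  qed
  have X': "place_customer ?k i Y = X"
    unfolding Y_def by (rule place_complete_service[where k = k and i = i and X = X, OF k(2,3)])
  have "(\<Sum>k\<in>?K. real (k j) * real (place_customer l i Y k)) = \<rho> j * r" for j
  proof -
    have "(\<Sum>k\<in>?K. real (k j) * real (place_customer l i Y k)) = (\<Sum>k\<in>?K. real (k j) * real (X k))"
      using cust[OF l, of j] cust[OF v, of j] unfolding X' by linarith
    then show ?thesis
      using X unfolding closed_states_def by simp
  qed
  moreover have "place_customer l i Y m = 0" if "m \<notin> ?K" for m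
    using place_customer_outside[OF l(2) that] complete_service_outside[OF K k(1) that] X that
    unfolding Y_def closed_states_def by blast
  ultimately show ?thesis
    unfolding next_state_def Let_def closed_states_def Y_def[symmetric] l_def[symmetric] by blast
qed

subsection \<open>Lyapunov drift\<close>

text \<open>The discrete primitive of \<open>m \<mapsto> m powr \<alpha>\<close> makes the change under a placement equal to the
  greedy increment up to the single difference \<open>m powr \<alpha> - (m - 1) powr \<alpha>\<close>.\<close>

definition lyapunov :: "'i config set \<Rightarrow> real \<Rightarrow> 'i state \<Rightarrow> real" where
  "lyapunov Kbar \<alpha> X = (\<Sum>k\<in>nonempty_configs Kbar. \<Sum>m<X k. real m powr \<alpha>)"

text \<open>The vacated server is itself available for the customer who leaves it, so the greedy choice
  is at least as good as undoing the departure; the gap is the gain over undoing it.\<close>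

definition greedy_gap ::
  "real \<Rightarrow> ('i state \<Rightarrow> 'i \<Rightarrow> 'i config) \<Rightarrow> 'i state \<Rightarrow> 'i config \<Rightarrow> 'i \<Rightarrow> real" where
  "greedy_gap \<alpha> \<sigma> X k i =
     (let Y = complete_service k i X
      in greedy_increment \<alpha> Y i (k(i := k i - 1)) - greedy_increment \<alpha> Y i (\<sigma> Y i))"

text \<open>The gaps weighted by the service completion rates. Up to the discretisation error, its
  negative bounds the drift of \<open>lyapunov\<close> from above.\<close>

definition dissipation ::
  "('i::finite) config set \<Rightarrow> ('i \<Rightarrow> real) \<Rightarrow> real \<Rightarrow> ('i state \<Rightarrow> 'i \<Rightarrow> 'i config) \<Rightarrow> 'i state \<Rightarrow> real" where
  "dissipation Kbar \<mu> \<alpha> \<sigma> X =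
     (\<Sum>k\<in>nonempty_configs Kbar. \<Sum>i\<in>UNIV. \<mu> i * real (k i) * real (X k) * greedy_gap \<alpha> \<sigma> X k i)"

lemma greedy_gap_nonneg:
  assumes "config_set Kbar" "greedy_rule Kbar \<alpha> \<sigma>" "k \<in> Kbar" "0 < k i"
  shows "0 \<le> greedy_gap \<alpha> \<sigma> X k i"
  unfolding greedy_gap_def Let_def
  using greedy_rule_le[OF assms(2) vacated_available[where k = k and i = i and X = X, OF assms(1,3,4)]] by simp

lemma dissipation_term_bounds:
  assumes K: "config_set Kbar" and \<sigma>: "greedy_rule Kbar \<alpha> \<sigma>" and \<mu>: "\<And>i. 0 < \<mu> i"
    and k: "k \<in> nonempty_configs Kbar"
  shows "0 \<le> \<mu> i * real (k i) * real (X k) * greedy_gap \<alpha> \<sigma> X k i"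
    and "\<mu> i * real (k i) * real (X k) * greedy_gap \<alpha> \<sigma> X k i \<le> dissipation Kbar \<mu> \<alpha> \<sigma> X"
proof -
  let ?t = "\<lambda>k i. \<mu> i * real (k i) * real (X k) * greedy_gap \<alpha> \<sigma> X k i"
  have nn: "0 \<le> ?t k i" if "k \<in> nonempty_configs Kbar" for k i
    using greedy_gap_nonneg[where k = k and i = i and X = X, OF K \<sigma>] that \<mu>[of i]
    unfolding nonempty_configs_def by (cases "k i = 0") auto
  show "0 \<le> ?t k i" using nn k .
  have "?t k i \<le> (\<Sum>i\<in>UNIV. ?t k i)"
    using nn k by (intro member_le_sum) auto
  also have "\<dots> \<le> (\<Sum>k\<in>nonempty_configs Kbar. \<Sum>i\<in>UNIV. ?t k i)"
    using nn k finite_nonempty_configs[OF K] by (intro member_le_sum[of k]) (auto intro!: sum_nonneg)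
  finally show "?t k i \<le> dissipation Kbar \<mu> \<alpha> \<sigma> X"
    unfolding dissipation_def .
qed

lemma dissipation_nonneg:
  assumes K: "config_set Kbar" and \<sigma>: "greedy_rule Kbar \<alpha> \<sigma>" and \<mu>: "\<And>i. 0 < \<mu> i"
  shows "0 \<le> dissipation Kbar \<mu> \<alpha> \<sigma> X"
  unfolding dissipation_def using dissipation_term_bounds(1)[of Kbar \<alpha> \<sigma> \<mu>] assms
  by (intro sum_nonneg) auto

text \<open>The server gained contributes exactly its part of the greedy increment. The server lost
  takes away \<open>(Y l - 1) powr \<alpha>\<close>, whereas the increment subtracts
  \<open>Y l powr \<alpha>\<close>; the last term corrects this.\<close>

lemma lyapunov_place_customer:
  assumes K: "config_set Kbar" and l: "l \<in> Kbar" "l(i := Suc (l i)) \<in> Kbar" "l \<noteq> (\<lambda>_. 0) \<Longrightarrow> 0 < Y l"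
  shows "lyapunov Kbar \<alpha> (place_customer l i Y) = lyapunov Kbar \<alpha> Y + greedy_increment \<alpha> Y i l
    + (if l \<noteq> (\<lambda>_. 0) then real (Y l) powr \<alpha> - real (Y l - 1) powr \<alpha> else 0)"
proof -
  have "(\<Sum>m<n. real m powr \<alpha>) - (\<Sum>m<n - 1. real m powr \<alpha>) = real (n - 1) powr \<alpha>" if "0 < n" for n
    using that by (cases n) auto
  then show ?thesis
    unfolding lyapunov_def sum_place_customer[OF K l(1) refl l(2), of "\<lambda>k n. \<Sum>m<n. real m powr \<alpha>"] greedy_increment_def
    using l(3) by auto
qed

text \<open>Compares two placements into the same intermediate state: the greedy one and the one
  restoring \<open>X\<close>. The discretisation error of the latter has a favourable sign, so only
  that of the greedy placement is charged to \<open>\<omega>\<close>.\<close>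

lemma lyapunov_next_state_le:
  assumes K: "config_set Kbar" and \<sigma>: "greedy_rule Kbar \<alpha> \<sigma>" and \<alpha>: "0 < \<alpha>"
    and X: "\<And>k. real (X k) \<le> r" and r: "1 \<le> r" and k: "k \<in> Kbar" "0 < k i" "0 < X k"
    and \<omega>: "\<And>m. 0 < m \<Longrightarrow> real m \<le> 2 * r \<Longrightarrow> real m powr \<alpha> - real (m - 1) powr \<alpha> \<le> \<omega>"
  shows "lyapunov Kbar \<alpha> (next_state \<sigma> k i X) \<le> lyapunov Kbar \<alpha> X - greedy_gap \<alpha> \<sigma> X k i + \<omega>"
proof -
  define Y where "Y = complete_service k i X"
  let ?k = "k(i := k i - 1)"
  let ?err = "\<lambda>l. if l \<noteq> (\<lambda>_. 0) then real (Y l) powr \<alpha> - real (Y l - 1) powr \<alpha> else 0"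
  have lyap: "lyapunov Kbar \<alpha> (place_customer l i Y) = lyapunov Kbar \<alpha> Y + greedy_increment \<alpha> Y i l + ?err l"
    if "l \<in> available Kbar Y i" for l
    using that by (intro lyapunov_place_customer[OF K]) (auto simp: available_def nonempty_configs_def)
  have "lyapunov Kbar \<alpha> (next_state \<sigma> k i X) = lyapunov Kbar \<alpha> Y + greedy_increment \<alpha> Y i (\<sigma> Y i) + ?err (\<sigma> Y i)"
    using lyap[OF greedy_rule_available[OF \<sigma>]] unfolding next_state_def Let_def Y_def by simp
  moreover have "lyapunov Kbar \<alpha> X = lyapunov Kbar \<alpha> Y + greedy_increment \<alpha> Y i ?k + ?err ?k"
    using lyap[of ?k] vacated_available[where k = k and i = i and X = X, OF K k(1,2)] place_complete_service[where k = k and i = i and X = X, OF k(2,3)]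
    unfolding Y_def by simp
  moreover have "?err (\<sigma> Y i) \<le> \<omega>"
  proof -
    have "real (Y (\<sigma> Y i)) \<le> 2 * r"
      using complete_service_le[of k i X "\<sigma> Y i"] X[of "\<sigma> Y i"] r unfolding Y_def by linarith
    then have "\<sigma> Y i \<noteq> (\<lambda>_. 0) \<Longrightarrow> ?err (\<sigma> Y i) \<le> \<omega>"
      using greedy_rule_available[OF \<sigma>, of Y i] \<omega>[of "Y (\<sigma> Y i)"] unfolding available_def by auto
    \<comment> \<open>A greedy choice of an empty server has error \<open>0\<close>, so the bound
      must be nonnegative; the difference at \<open>m = 1\<close> supplies this.\<close>
    moreover have "0 \<le> \<omega>"
      using \<omega>[of 1] r \<alpha> by simp
    ultimately show ?thesis by auto
  qed
  moreover have "0 \<le> ?err ?k"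
    using \<alpha> by (auto intro!: powr_mono2)
  ultimately show ?thesis
    unfolding greedy_gap_def Let_def Y_def[symmetric] by linarith
qed

subsection \<open>Stationary distributions\<close>

text \<open>The diagonal entry turns the row sum into differences \<open>f y - f x\<close>, in which
  self-transitions (a greedy rule may undo a departure) cancel.\<close>

lemma sum_generator:
  assumes "finite S" "x \<in> S"
  shows "(\<Sum>y\<in>S. generator S q x y * f y) = (\<Sum>y\<in>S. q x y * (f y - f x))"
proof -
  have "(\<Sum>y\<in>S. generator S q x y * f y) =
      - (\<Sum>y\<in>S - {x}. q x y) * f x + (\<Sum>y\<in>S - {x}. generator S q x y * f y)"
    by (subst sum.remove[OF assms]) (simp add: generator_def)
  also have "(\<Sum>y\<in>S - {x}. generator S q x y * f y) = (\<Sum>y\<in>S - {x}. q x y * f y)"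
    by (intro sum.cong) (auto simp: generator_def)
  also have "- (\<Sum>y\<in>S - {x}. q x y) * f x + \<dots> = (\<Sum>y\<in>S - {x}. q x y * (f y - f x))"
    by (simp add: sum_distrib_right sum_subtractf right_diff_distrib)
  also have "\<dots> = (\<Sum>y\<in>S. q x y * (f y - f x))"
    by (subst sum.remove[OF assms]) simp
  finally show ?thesis .
qed

text \<open>Regroups the transitions by departing customer instead of by target state. Events of
  rate zero may lead outside \<open>S\<close>, but they contribute \<open>0\<close> to both
  sides.\<close>

lemma sum_jump_rate:
  assumes S: "finite S"
    and closed: "\<And>k i. k \<in> nonempty_configs Kbar \<Longrightarrow> 0 < k i \<Longrightarrow> 0 < X k \<Longrightarrow> next_state \<sigma> k i X \<in> S"
  shows "(\<Sum>Y\<in>S. jump_rate Kbar \<mu> \<sigma> X Y * g Y) =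
    (\<Sum>k\<in>nonempty_configs Kbar. \<Sum>i\<in>UNIV. \<mu> i * real (k i) * real (X k) * g (next_state \<sigma> k i X))"
proof -
  have "(\<Sum>Y\<in>S. jump_rate Kbar \<mu> \<sigma> X Y * g Y) =
    (\<Sum>Y\<in>S. \<Sum>k\<in>nonempty_configs Kbar. \<Sum>i\<in>UNIV.
       if next_state \<sigma> k i X = Y then \<mu> i * real (k i) * real (X k) * g Y else 0)"
    unfolding jump_rate_def sum_distrib_right by (intro sum.cong) auto
  also have "\<dots> = (\<Sum>k\<in>nonempty_configs Kbar. \<Sum>Y\<in>S. \<Sum>i\<in>UNIV.
       if next_state \<sigma> k i X = Y then \<mu> i * real (k i) * real (X k) * g Y else 0)"
    by (rule sum.swap)
  also have "\<dots> = (\<Sum>k\<in>nonempty_configs Kbar. \<Sum>i\<in>UNIV. \<Sum>Y\<in>S.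
       if next_state \<sigma> k i X = Y then \<mu> i * real (k i) * real (X k) * g Y else 0)"
    by (intro sum.cong[OF refl] sum.swap)
  also have "\<dots> = (\<Sum>k\<in>nonempty_configs Kbar. \<Sum>i\<in>UNIV. \<mu> i * real (k i) * real (X k) * g (next_state \<sigma> k i X))"
  proof (intro sum.cong refl)
    fix k i assume k: "k \<in> nonempty_configs Kbar"
    show "(\<Sum>Y\<in>S. if next_state \<sigma> k i X = Y then \<mu> i * real (k i) * real (X k) * g Y else 0) =
        \<mu> i * real (k i) * real (X k) * g (next_state \<sigma> k i X)"
      using S closed[OF k, of i] by (cases "0 < k i \<and> 0 < X k") (auto simp: sum.delta')
  qed
  finally show ?thesis .
qed

text \<open>A crude geometric bound, enough for the exponential series to converge absolutely for
  all times.\<close>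

lemma kernel_power_bound:
  assumes S: "finite S" and Q: "\<And>x y. x \<in> S \<Longrightarrow> y \<in> S \<Longrightarrow> \<bar>Q x y\<bar> \<le> C" and "0 \<le> C" "y \<in> S"
  shows "x \<in> S \<Longrightarrow> \<bar>kernel_power S Q n x y\<bar> \<le> (real (card S) * C) ^ n"
proof (induction n arbitrary: x)
  case (Suc n)
  have "\<bar>kernel_power S Q (Suc n) x y\<bar> \<le> (\<Sum>z\<in>S. \<bar>Q x z * kernel_power S Q n z y\<bar>)"
    by (simp add: sum_abs)
  also have "\<dots> \<le> (\<Sum>z\<in>S. C * (real (card S) * C) ^ n)"
    unfolding abs_mult using Suc Q \<open>0 \<le> C\<close> by (intro sum_mono mult_mono) auto
  finally show ?case by simp
qed auto

text \<open>For fixed \<open>y\<close> the mass at time \<open>t\<close> is a power series in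
  \<open>t\<close> that is constant for \<open>t \<ge> 0\<close>; its linear coefficient is the sum
  in question and must vanish.\<close>

lemma stationary_generator:
  assumes S: "finite S" and st: "stationary_distribution S q N" and y: "y \<in> S"
  shows "(\<Sum>x\<in>S. measure N {x} * generator S q x y) = 0"
proof -
  let ?Q = "generator S q"
  define C where "C = (\<Sum>x\<in>S. \<Sum>y\<in>S. \<bar>?Q x y\<bar>)"
  have C: "\<bar>?Q x z\<bar> \<le> C" if "x \<in> S" "z \<in> S" for x z
  proof -
    have "\<bar>?Q x z\<bar> \<le> (\<Sum>y\<in>S. \<bar>?Q x y\<bar>)"
      using S that by (intro member_le_sum) auto
    also have "\<dots> \<le> C"
      unfolding C_def using S that by (intro member_le_sum[of x]) (auto intro: sum_nonneg)
    finally show ?thesis .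
  qed
  have "0 \<le> C" unfolding C_def by (intro sum_nonneg) auto
  define a where "a n = (\<Sum>x\<in>S. measure N {x} * kernel_power S ?Q n x y) / fact n" for n
  have summ: "summable (\<lambda>n. t ^ n / fact n * kernel_power S ?Q n x y)" if "x \<in> S" for t x
  proof (rule summable_comparison_test')
    show "summable (\<lambda>n. (\<bar>t\<bar> * (real (card S) * C)) ^ n / fact n)"
      using summable_exp[of "\<bar>t\<bar> * (real (card S) * C)"] by (simp add: field_simps)
    fix n
    show "norm (t ^ n / fact n * kernel_power S ?Q n x y) \<le> (\<bar>t\<bar> * (real (card S) * C)) ^ n / fact n"
      using kernel_power_bound[OF S C \<open>0 \<le> C\<close> y that, where n = n]
      by (auto simp: abs_mult power_abs power_mult_distrib divide_simps intro!: mult_left_mono)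
  qed
  have sums: "(\<lambda>n. a n * t ^ n) sums (\<Sum>x\<in>S. measure N {x} * transition_function S q t x y)" for t
  proof -
    have "(\<lambda>n. \<Sum>x\<in>S. measure N {x} * (t ^ n / fact n * kernel_power S ?Q n x y)) sums
        (\<Sum>x\<in>S. measure N {x} * transition_function S q t x y)"
      unfolding transition_function_def using summ by (intro sums_sum sums_mult summable_sums) auto
    moreover have "(\<Sum>x\<in>S. measure N {x} * (t ^ n / fact n * kernel_power S ?Q n x y)) = a n * t ^ n" for n
      unfolding a_def sum_divide_distrib sum_distrib_right by (intro sum.cong) simp_all
    ultimately show ?thesis by simp
  qed
  let ?f = "\<lambda>t::real. \<Sum>n. a n * t ^ n"
  have const: "?f t = measure N {y}" if "0 \<le> t" for t
    using sums_unique[OF sums[of t]] st y that unfolding stationary_distribution_def by auto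
  have "(?f has_field_derivative (\<Sum>n. diffs a n * 0 ^ n)) (at 0)"
    using sums_summable[OF sums[of 1]] by (intro termdiffs_strong[of a 1]) auto
  moreover have "(\<Sum>n. diffs a n * 0 ^ n) = a 1"
    by (simp add: diffs_def)
  ultimately have der: "(?f has_field_derivative a 1) (at 0)" by simp
  \<comment> \<open>Stationarity concerns nonnegative times only, so the derivative at
    \<open>0\<close> is evaluated along the positive sequence \<open>1 / (n + 1)\<close>.\<close>
  have "a 1 = 0"
  proof (rule field_derivative_lim_unique[OF der])
    show "(\<lambda>n. inverse (real (Suc n))) \<longlonglongrightarrow> 0"
      by (rule LIMSEQ_inverse_real_of_nat)
    show "(\<lambda>n. (?f (0 + inverse (real (Suc n))) - ?f 0) / inverse (real (Suc n))) \<longlonglongrightarrow> 0"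
      using const[of 0] const[of "inverse (real (Suc n))" for n] by simp
  qed auto
  moreover have "kernel_power S ?Q 1 x y = ?Q x y" for x
    using S y by (simp add: sum.delta if_distrib[of "\<lambda>u. _ * u"] cong: if_cong)
  ultimately show ?thesis
    unfolding a_def by simp
qed

lemma stationary_jump_balance:
  fixes f :: "'s \<Rightarrow> real"
  assumes S: "finite S" and st: "stationary_distribution S q N"
  shows "(\<Sum>x\<in>S. measure N {x} * (\<Sum>y\<in>S. q x y * (f y - f x))) = 0"
proof -
  have "(\<Sum>x\<in>S. measure N {x} * (\<Sum>y\<in>S. q x y * (f y - f x))) =
      (\<Sum>x\<in>S. \<Sum>y\<in>S. measure N {x} * generator S q x y * f y)"
    by (intro sum.cong refl) (simp add: sum_distrib_left mult.assoc flip: sum_generator[OF S])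
  also have "\<dots> = (\<Sum>y\<in>S. (\<Sum>x\<in>S. measure N {x} * generator S q x y) * f y)"
    unfolding sum_distrib_right by (rule sum.swap)
  also have "\<dots> = 0"
    by (simp add: stationary_generator[OF S st])
  finally show ?thesis .
qed

subsection \<open>Fluid limits\<close>

lemma fluid_limit_polyhedron:
  assumes r: "\<And>j. 1 \<le> r j"
    and X: "\<And>j. X j \<in> closed_states Kbar \<rho> (r j)"
    and lim: "(\<lambda>j. fluid_scaled (r j) (X j)) \<longlonglongrightarrow> x"
  shows "x \<in> fluid_polyhedron Kbar \<rho>"
proof -
  let ?K = "nonempty_configs Kbar"
  have lim: "(\<lambda>j. real (X j k) / r j) \<longlonglongrightarrow> x k" for k
    using lim unfolding tendsto_fun_iff fluid_scaled_def by blast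
  have rpos: "0 < r j" for j
    using r[of j] by linarith
  have "x k = 0" if "k \<notin> ?K" for k
  proof -
    have "X j k = 0" for j
      using X[of j] that unfolding closed_states_def by auto
    then show ?thesis
      using lim[of k] by (simp add: LIMSEQ_const_iff)
  qed
  moreover have "0 \<le> x k" for k
    using lim[of k] rpos by (rule_tac LIMSEQ_le_const) (auto intro!: exI[of _ 0] divide_nonneg_pos)
  moreover have "(\<Sum>k\<in>?K. real (k i) * x k) = \<rho> i" for i
  proof -
    have "(\<lambda>j. \<Sum>k\<in>?K. real (k i) * (real (X j k) / r j)) \<longlonglongrightarrow> (\<Sum>k\<in>?K. real (k i) * x k)"
      by (intro tendsto_intros lim)
    moreover have "(\<Sum>k\<in>?K. real (k i) * (real (X j k) / r j)) = \<rho> i" for j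
    proof -
      have "(\<Sum>k\<in>?K. real (k i) * (real (X j k) / r j)) = (\<Sum>k\<in>?K. real (k i) * real (X j k)) / r j"
        by (simp add: sum_divide_distrib)
      also have "\<dots> = \<rho> i"
        using X[of j] rpos[of j] unfolding closed_states_def by simp
      finally show ?thesis .
    qed
    ultimately show ?thesis
      by (simp add: LIMSEQ_const_iff)
  qed
  ultimately show ?thesis
    unfolding fluid_polyhedron_def by blast
qed

text \<open>Since \<open>x k > 0\<close>, type \<open>i\<close> customers leave servers of
  configuration \<open>k\<close> at a rate of order \<open>r\<close>, and each of them could join
  \<open>l\<close>. If the inequality failed, these departures would have gaps of order
  \<open>r powr \<alpha>\<close>, hence dissipation of order \<open>r powr (1 + \<alpha>)\<close>,
  against \<open>diss\<close>.\<close>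

lemma fluid_limit_increments:
  assumes K: "config_set Kbar" and \<mu>: "\<And>i. 0 < \<mu> i" and \<alpha>: "0 < \<alpha>"
    and r: "\<And>j. 1 \<le> r j" "filterlim r at_top sequentially"
    and \<sigma>: "\<And>j. greedy_rule Kbar \<alpha> (\<sigma> j)"
    and X: "\<And>j. X j \<in> closed_states Kbar \<rho> (r j)"
    and diss: "(\<lambda>j. dissipation Kbar \<mu> \<alpha> (\<sigma> j) (X j) / r j powr (1 + \<alpha>)) \<longlonglongrightarrow> 0"
    and lim: "(\<lambda>j. fluid_scaled (r j) (X j)) \<longlonglongrightarrow> x"
    and k: "k \<in> nonempty_configs Kbar" "0 < k i" "0 < x k"
    and l: "l \<in> Kbar" "l(i := Suc (l i)) \<in> Kbar" "l = (\<lambda>_. 0) \<or> 0 < x l"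
  shows "x k powr \<alpha> - x (k(i := k i - 1)) powr \<alpha> \<le> x (l(i := Suc (l i))) powr \<alpha> - x l powr \<alpha>"
proof -
  define k' where "k' = k(i := k i - 1)"
  define Y where "Y j = complete_service k i (X j)" for j
  define g where "g m j = greedy_increment \<alpha> (Y j) i m / r j powr \<alpha>" for m j
  have kk: "k'(i := Suc (k' i)) = k"
    using k(2) unfolding k'_def by auto
  have rpos: "0 < r j" for j
    using r(1)[of j] by linarith
  have x: "x \<in> fluid_polyhedron Kbar \<rho>"
    by (rule fluid_limit_polyhedron[OF r(1) X lim])
  then have x0: "x (\<lambda>_. 0) = 0"
    unfolding fluid_polyhedron_def nonempty_configs_def by blast
  have limX: "(\<lambda>j. real (X j m) / r j) \<longlonglongrightarrow> x m" for m
    using lim unfolding tendsto_fun_iff fluid_scaled_def by blast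
  have inv: "(\<lambda>j. 1 / r j) \<longlonglongrightarrow> 0"
    by (rule tendsto_divide_0[OF tendsto_const filterlim_at_top_imp_at_infinity[OF r(2)]])
  \<comment> \<open>One departure changes each count by at most one, which disappears after division
    by \<open>r j\<close>.\<close>
  have limY: "(\<lambda>j. real (Y j m) / r j) \<longlonglongrightarrow> x m" for m
  proof -
    have "(\<lambda>j. real (Y j m) / r j - real (X j m) / r j) \<longlonglongrightarrow> 0"
    proof (rule Lim_null_comparison[OF _ inv], intro always_eventually allI)
      fix j
      have "\<bar>real (Y j m) - real (X j m)\<bar> \<le> 1"
        using complete_service_le[of k i "X j" m] complete_service_ge[of "X j" m k i]
        unfolding Y_def by linarith
      then show "norm (real (Y j m) / r j - real (X j m) / r j) \<le> 1 / r j"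
        using rpos[of j] by (simp add: divide_right_mono flip: diff_divide_distrib)
    qed
    from tendsto_add[OF this limX[of m]] show ?thesis by simp
  qed
  have limp: "(\<lambda>j. real (Y j m) powr \<alpha> / r j powr \<alpha>) \<longlonglongrightarrow> x m powr \<alpha>" for m
  proof -
    have "(\<lambda>j. (real (Y j m) / r j) powr \<alpha>) \<longlonglongrightarrow> x m powr \<alpha>"
      using \<alpha> rpos by (intro tendsto_powr'[OF limY]) (auto intro!: always_eventually divide_nonneg_pos)
    then show ?thesis
      using rpos by (simp add: powr_divide less_imp_le)
  qed
  \<comment> \<open>At the empty configuration the greedy increment has no second term, in agreement
    with \<open>x (\<lambda>_. 0) = 0\<close>.\<close>
  have limg: "g m \<longlonglongrightarrow> x (m(i := Suc (m i))) powr \<alpha> - x m powr \<alpha>" for m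
  proof (cases "m = (\<lambda>_. 0)")
    case True
    then have "g m = (\<lambda>j. real (Y j (m(i := Suc (m i)))) powr \<alpha> / r j powr \<alpha>)"
      by (simp add: g_def[abs_def] greedy_increment_def)
    with limp[of "m(i := Suc (m i))"] True x0 show ?thesis by simp
  next
    case False
    then have "g m = (\<lambda>j. real (Y j (m(i := Suc (m i)))) powr \<alpha> / r j powr \<alpha> - real (Y j m) powr \<alpha> / r j powr \<alpha>)"
      by (simp add: g_def[abs_def] greedy_increment_def diff_divide_distrib)
    with tendsto_diff[OF limp[of "m(i := Suc (m i))"] limp[of m]] show ?thesis by simp
  qed
  \<comment> \<open>A positive limit \<open>x l\<close> forces a server of configuration
    \<open>l\<close> to exist eventually, so \<open>l\<close> competes with the greedy
    choice.\<close>
  have avail: "eventually (\<lambda>j. l \<in> available Kbar (Y j) i) sequentially"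
  proof (cases "l = (\<lambda>_. 0)")
    case True
    have "l(i := Suc (l i)) \<noteq> (\<lambda>_. 0)" by (auto simp: fun_eq_iff)
    with l True show ?thesis
      by (intro always_eventually) (simp add: available_def nonempty_configs_def)
  next
    case False
    with l have "0 < x l" by blast
    have ne: "l(i := Suc (l i)) \<noteq> (\<lambda>_. 0)" by (auto simp: fun_eq_iff)
    show ?thesis
      using order_tendstoD(1)[OF limY[of l] \<open>0 < x l\<close>]
    proof eventually_elim
      case (elim j)
      then have "0 < Y j l" by (cases "Y j l = 0") auto
      with l ne show ?case by (simp add: available_def nonempty_configs_def)
    qed
  qed
  have "\<mu> i * real (k i) * x k * ((x (k'(i := Suc (k' i))) powr \<alpha> - x k' powr \<alpha>) -
      (x (l(i := Suc (l i))) powr \<alpha> - x l powr \<alpha>)) \<le> 0"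
  proof (rule tendsto_le[OF _ diss])
    show "(\<lambda>j. \<mu> i * real (k i) * (real (X j k) / r j) * (g k' j - g l j)) \<longlonglongrightarrow>
      \<mu> i * real (k i) * x k * ((x (k'(i := Suc (k' i))) powr \<alpha> - x k' powr \<alpha>) -
        (x (l(i := Suc (l i))) powr \<alpha> - x l powr \<alpha>))"
      by (intro tendsto_intros limX limg)
    show "eventually (\<lambda>j. \<mu> i * real (k i) * (real (X j k) / r j) * (g k' j - g l j) \<le>
      dissipation Kbar \<mu> \<alpha> (\<sigma> j) (X j) / r j powr (1 + \<alpha>)) sequentially"
      using avail
    proof eventually_elim
      case (elim j)
      let ?c = "\<mu> i * real (k i) * real (X j k)"
      have "greedy_increment \<alpha> (Y j) i k' - greedy_increment \<alpha> (Y j) i l \<le> greedy_gap \<alpha> (\<sigma> j) (X j) k i"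
        using greedy_rule_le[OF \<sigma> elim] unfolding greedy_gap_def Let_def Y_def k'_def by simp
      then have "?c * (greedy_increment \<alpha> (Y j) i k' - greedy_increment \<alpha> (Y j) i l) \<le>
          ?c * greedy_gap \<alpha> (\<sigma> j) (X j) k i"
        using \<mu>[of i] by (intro mult_left_mono) auto
      also have "\<dots> \<le> dissipation Kbar \<mu> \<alpha> (\<sigma> j) (X j)"
        by (rule dissipation_term_bounds(2)[OF K \<sigma> \<mu> k(1)])
      finally have "?c * (greedy_increment \<alpha> (Y j) i k' - greedy_increment \<alpha> (Y j) i l) / r j powr (1 + \<alpha>)
          \<le> dissipation Kbar \<mu> \<alpha> (\<sigma> j) (X j) / r j powr (1 + \<alpha>)"
        by (intro divide_right_mono) auto
      \<comment> \<open>The scaling \<open>r j powr (1 + \<alpha>)\<close> splits into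
        \<open>r j\<close> for the departure rate and \<open>r j powr \<alpha>\<close> for the
        increments.\<close>
      moreover have "?c * (greedy_increment \<alpha> (Y j) i k' - greedy_increment \<alpha> (Y j) i l) / r j powr (1 + \<alpha>)
          = \<mu> i * real (k i) * (real (X j k) / r j) * (g k' j - g l j)"
        unfolding g_def using rpos[of j] by (simp add: powr_add field_simps)
      ultimately show ?case by linarith
    qed
  qed simp
  then show ?thesis
    using \<mu>[of i] k(2,3) unfolding kk unfolding k'_def by (simp add: mult_le_0_iff)
qed

text \<open>The least increments \<open>\<eta> i\<close> act as multipliers for
  \<open>h k = x k powr \<alpha>\<close>: minimality gives the upward one-step inequality,
  \<open>fluid_limit_increments\<close> the downward one, and together they yield the optimality
  conditions.\<close>

lemma fluid_limit_minimizer: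
  assumes K: "config_set Kbar" and \<mu>: "\<And>i. 0 < \<mu> i" and \<alpha>: "0 < \<alpha>"
    and r: "\<And>j. 1 \<le> r j" "filterlim r at_top sequentially"
    and \<sigma>: "\<And>j. greedy_rule Kbar \<alpha> (\<sigma> j)"
    and X: "\<And>j. X j \<in> closed_states Kbar \<rho> (r j)"
    and diss: "(\<lambda>j. dissipation Kbar \<mu> \<alpha> (\<sigma> j) (X j) / r j powr (1 + \<alpha>)) \<longlonglongrightarrow> 0"
    and lim: "(\<lambda>j. fluid_scaled (r j) (X j)) \<longlonglongrightarrow> x"
    and y: "y \<in> fluid_polyhedron Kbar \<rho>" "y \<noteq> x"
  shows "fluid_objective Kbar \<alpha> x < fluid_objective Kbar \<alpha> y"
proof -
  have x: "x \<in> fluid_polyhedron Kbar \<rho>"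
    by (rule fluid_limit_polyhedron[OF r(1) X lim])
  then have x0: "x (\<lambda>_. 0) = 0"
    unfolding fluid_polyhedron_def nonempty_configs_def by blast
  have xout: "k \<in> nonempty_configs Kbar" if "0 < x k powr \<alpha>" for k
    using x that unfolding fluid_polyhedron_def by force
  \<comment> \<open>In HOL \<open>powr\<close> is positive on negative bases too, so the sign of
    \<open>x k\<close> has to come from the polyhedron.\<close>
  have xpos: "0 < x k" if "0 < x k powr \<alpha>" for k
  proof -
    have "0 \<le> x k"
      using x xout[OF that] unfolding fluid_polyhedron_def by blast
    with that show ?thesis by (cases "x k = 0") auto
  qed
  define A where "A i = {l \<in> Kbar. l(i := Suc (l i)) \<in> Kbar \<and> (l = (\<lambda>_. 0) \<or> 0 < x l)}" for i
  define \<eta> where "\<eta> i = Min ((\<lambda>l. x (l(i := Suc (l i))) powr \<alpha> - x l powr \<alpha>) ` A i)" for i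
  \<comment> \<open>Unit configurations lie in \<open>Kbar\<close>, so the empty configuration
    always competes and the minimum is over a nonempty set.\<close>
  have A: "finite (A i)" "(\<lambda>_. 0) \<in> A i" for i
    using K unfolding A_def config_set_def by (auto simp: unit_config_def)
  have up: "x l powr \<alpha> + \<eta> i \<le> x (l(i := Suc (l i))) powr \<alpha>"
    if "l(i := Suc (l i)) \<in> Kbar" "l = (\<lambda>_. 0) \<or> 0 < x l powr \<alpha>" for l i
  proof -
    have "l \<le> l(i := Suc (l i))"
      by (auto simp: le_fun_def)
    then have "l \<in> Kbar"
      using that(1) K unfolding config_set_def by blast
    with that xpos have "l \<in> A i"
      unfolding A_def by blast
    then have "\<eta> i \<le> x (l(i := Suc (l i))) powr \<alpha> - x l powr \<alpha>"
      unfolding \<eta>_def using A by (intro Min_le) auto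
    then show ?thesis by simp
  qed
  have down: "x k powr \<alpha> \<le> x (k(i := k i - 1)) powr \<alpha> + \<eta> i"
    if "k \<in> Kbar" "0 < k i" "0 < x k powr \<alpha>" for k i
  proof -
    have "x k powr \<alpha> - x (k(i := k i - 1)) powr \<alpha> \<le> x (l(i := Suc (l i))) powr \<alpha> - x l powr \<alpha>"
      if l: "l \<in> A i" for l
      by (rule fluid_limit_increments[where k = k and i = i and l = l, OF K \<mu> \<alpha> r \<sigma> X diss lim])
        (use l xpos xout \<open>0 < k i\<close> \<open>0 < x k powr \<alpha>\<close> in \<open>auto simp: A_def\<close>)
    then have "x k powr \<alpha> - x (k(i := k i - 1)) powr \<alpha> \<le> \<eta> i"
      unfolding \<eta>_def using A[of i] by (subst Min_ge_iff) blast+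
    then show ?thesis by simp
  qed
  show ?thesis
  proof (rule fluid_objective_less[OF K \<alpha> x y, of \<eta>])
    fix k assume k: "k \<in> Kbar"
    show "(\<Sum>i\<in>UNIV. \<eta> i * real (k i)) \<le> x k powr \<alpha>"
      by (rule downset_dominance[where h = "\<lambda>k. x k powr \<alpha>", OF K k powr_ge_zero up])
    assume "0 < x k"
    then show "x k powr \<alpha> = (\<Sum>i\<in>UNIV. \<eta> i * real (k i))"
      by (intro downset_complementary_slackness[where h = "\<lambda>k. x k powr \<alpha>", OF K k powr_ge_zero _ up down])
        (auto simp: x0)
  qed
qed

text \<open>Compactness of the scaled states, combined with the description of limit points. It
  serves twice: to produce the minimizer, and to identify the limit of any other sequence of states
  of vanishing dissipation.\<close>

lemma low_dissipation_subsequence: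
  assumes K: "config_set Kbar" and \<mu>: "\<And>i. 0 < \<mu> i" and \<alpha>: "0 < \<alpha>" and \<rho>: "\<And>i. \<rho> i \<le> 1"
    and r: "\<And>j. 1 \<le> r j" "filterlim r at_top sequentially"
    and \<sigma>: "\<And>j. greedy_rule Kbar \<alpha> (\<sigma> j)"
    and X: "\<And>j. X j \<in> closed_states Kbar \<rho> (r j)"
    and diss: "(\<lambda>j. dissipation Kbar \<mu> \<alpha> (\<sigma> j) (X j) / r j powr (1 + \<alpha>)) \<longlonglongrightarrow> 0"
  obtains s x where "strict_mono s" "(\<lambda>j. fluid_scaled (r (s j)) (X (s j))) \<longlonglongrightarrow> x"
    "x \<in> fluid_polyhedron Kbar \<rho>"
    "\<And>y. y \<in> fluid_polyhedron Kbar \<rho> \<Longrightarrow> y \<noteq> x \<Longrightarrow> fluid_objective Kbar \<alpha> x < fluid_objective Kbar \<alpha> y"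
proof -
  have "\<bar>fluid_scaled (r j) (X j) k\<bar> \<le> 1" for j k
    using closed_states_le[OF K \<rho> _ X, of j k] r(1)[of j] unfolding fluid_scaled_def by simp
  moreover have "fluid_scaled (r j) (X j) k = 0" if "k \<notin> nonempty_configs Kbar" for j k
    using X[of j] that unfolding closed_states_def fluid_scaled_def by simp
  ultimately obtain s x where s: "strict_mono s"
      and "((\<lambda>j. fluid_scaled (r j) (X j)) \<circ> s) \<longlonglongrightarrow> x"
    by (rule bounded_finite_support_subsequence[of "nonempty_configs Kbar" "\<lambda>j. fluid_scaled (r j) (X j)" 1])
  then have lim: "(\<lambda>j. fluid_scaled (r (s j)) (X (s j))) \<longlonglongrightarrow> x"
    by (simp add: o_def)
  have sub: "filterlim s sequentially sequentially"
    using s by (rule filterlim_subseq)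
  show thesis
  proof (rule that[OF s lim])
    show "x \<in> fluid_polyhedron Kbar \<rho>"
      by (rule fluid_limit_polyhedron[OF r(1) X lim])
    fix y assume "y \<in> fluid_polyhedron Kbar \<rho>" "y \<noteq> x"
    then show "fluid_objective Kbar \<alpha> x < fluid_objective Kbar \<alpha> y"
      by (rule fluid_limit_minimizer[OF K \<mu> \<alpha> r(1) filterlim_compose[OF r(2) sub] \<sigma> X
            filterlim_compose[OF diss sub] lim])
  qed
qed

text \<open>The drift inequality is averaged over the stationary law, under which the mean drift of
  \<open>lyapunov\<close> is zero. The total departure rate is the same in every state because the
  population of each type is fixed, so the error \<open>\<omega>\<close> per departure is multiplied
  by a constant rate.\<close>

lemma stationary_dissipation_le:
  assumes K: "config_set Kbar" and \<mu>: "\<And>i. 0 < \<mu> i" and \<alpha>: "0 < \<alpha>" and \<rho>: "\<And>i. \<rho> i \<le> 1"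
    and r: "1 \<le> r" and \<sigma>: "greedy_rule Kbar \<alpha> \<sigma>"
    and st: "stationary_distribution (closed_states Kbar \<rho> r) (jump_rate Kbar \<mu> \<sigma>) N"
    and mass: "(\<Sum>X\<in>closed_states Kbar \<rho> r. measure N {X}) = 1"
    and \<omega>: "\<And>m. 0 < m \<Longrightarrow> real m \<le> 2 * r \<Longrightarrow> real m powr \<alpha> - real (m - 1) powr \<alpha> \<le> \<omega>"
  shows "(\<Sum>X\<in>closed_states Kbar \<rho> r. measure N {X} * dissipation Kbar \<mu> \<alpha> \<sigma> X)
    \<le> \<omega> * (\<Sum>i\<in>UNIV. \<mu> i * \<rho> i) * r"
proof -
  let ?S = "closed_states Kbar \<rho> r" and ?K = "nonempty_configs Kbar"
  let ?L = "lyapunov Kbar \<alpha>"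
  have S: "finite ?S"
    using r by (intro finite_closed_states[OF K \<rho>]) auto
  have rate: "(\<Sum>k\<in>?K. \<Sum>i\<in>UNIV. \<mu> i * real (k i) * real (X k)) = (\<Sum>i\<in>UNIV. \<mu> i * \<rho> i) * r"
    if "X \<in> ?S" for X
  proof -
    have "(\<Sum>k\<in>?K. \<Sum>i\<in>UNIV. \<mu> i * real (k i) * real (X k)) =
        (\<Sum>i\<in>UNIV. \<mu> i * (\<Sum>k\<in>?K. real (k i) * real (X k)))"
      unfolding sum_distrib_left mult.assoc by (rule sum.swap)
    also have "\<dots> = (\<Sum>i\<in>UNIV. \<mu> i * \<rho> i) * r"
      using that unfolding closed_states_def sum_distrib_right by (simp add: mult.assoc)
    finally show ?thesis .
  qed
  have drift: "(\<Sum>Y\<in>?S. jump_rate Kbar \<mu> \<sigma> X Y * (?L Y - ?L X)) \<le>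
      \<omega> * (\<Sum>i\<in>UNIV. \<mu> i * \<rho> i) * r - dissipation Kbar \<mu> \<alpha> \<sigma> X" if X: "X \<in> ?S" for X
  proof -
    have Xr: "real (X k) \<le> r" for k
      using closed_states_le[OF K \<rho> _ X] r by auto
    have "(\<Sum>Y\<in>?S. jump_rate Kbar \<mu> \<sigma> X Y * (?L Y - ?L X)) =
        (\<Sum>k\<in>?K. \<Sum>i\<in>UNIV. \<mu> i * real (k i) * real (X k) * (?L (next_state \<sigma> k i X) - ?L X))"
      using next_state_closed[OF K \<sigma> X] by (intro sum_jump_rate[OF S]) (auto simp: nonempty_configs_def)
    also have "\<dots> \<le> (\<Sum>k\<in>?K. \<Sum>i\<in>UNIV. \<mu> i * real (k i) * real (X k) * (\<omega> - greedy_gap \<alpha> \<sigma> X k i))"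
    proof (intro sum_mono)
      fix k i assume k: "k \<in> ?K"
      show "\<mu> i * real (k i) * real (X k) * (?L (next_state \<sigma> k i X) - ?L X) \<le>
          \<mu> i * real (k i) * real (X k) * (\<omega> - greedy_gap \<alpha> \<sigma> X k i)"
      proof (cases "0 < k i \<and> 0 < X k")
        case True
        then have "?L (next_state \<sigma> k i X) \<le> ?L X - greedy_gap \<alpha> \<sigma> X k i + \<omega>"
          using k by (intro lyapunov_next_state_le[OF K \<sigma> \<alpha> Xr r _ _ _ \<omega>]) (auto simp: nonempty_configs_def)
        then show ?thesis
          using \<mu>[of i] by (intro mult_left_mono) auto
      qed auto
    qed
    also have "\<dots> = \<omega> * (\<Sum>k\<in>?K. \<Sum>i\<in>UNIV. \<mu> i * real (k i) * real (X k)) - dissipation Kbar \<mu> \<alpha> \<sigma> X"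
      unfolding dissipation_def sum_distrib_left sum_subtractf[symmetric]
      by (intro sum.cong refl) (simp add: algebra_simps)
    finally show ?thesis
      unfolding rate[OF X] by (simp add: mult.assoc)
  qed
  have "0 = (\<Sum>X\<in>?S. measure N {X} * (\<Sum>Y\<in>?S. jump_rate Kbar \<mu> \<sigma> X Y * (?L Y - ?L X)))"
    using stationary_jump_balance[OF S st, of ?L] by simp
  also have "\<dots> \<le> (\<Sum>X\<in>?S. measure N {X} * (\<omega> * (\<Sum>i\<in>UNIV. \<mu> i * \<rho> i) * r - dissipation Kbar \<mu> \<alpha> \<sigma> X))"
    using drift by (intro sum_mono mult_left_mono) auto
  also have "\<dots> = \<omega> * (\<Sum>i\<in>UNIV. \<mu> i * \<rho> i) * r * (\<Sum>X\<in>?S. measure N {X})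
      - (\<Sum>X\<in>?S. measure N {X} * dissipation Kbar \<mu> \<alpha> \<sigma> X)"
    unfolding sum_distrib_left sum_subtractf[symmetric]
    by (intro sum.cong refl) (simp add: algebra_simps)
  finally show ?thesis
    unfolding mass by simp
qed

section \<open>Convergence of the stationary states\<close>

lemma integral_finite_count_space:
  fixes g :: "'a \<Rightarrow> real"
  assumes "finite_measure N" "sets N = sets (count_space S)" "finite S"
  shows "integral\<^sup>L N g = (\<Sum>x\<in>S. measure N {x} * g x)"
proof -
  interpret finite_measure N by fact
  have sp: "space N = S"
    using sets_eq_imp_space_eq[OF assms(2)] by simp
  have "integral\<^sup>L N g = (\<integral>x. (\<Sum>s\<in>S. indicator {s} x * g s) \<partial>N)"
    using \<open>finite S\<close> by (intro Bochner_Integration.integral_cong refl)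
      (simp add: sp indicator_def if_distrib[of "\<lambda>u. u * _"] sum.delta' cong: if_cong)
  also have "\<dots> = (\<Sum>s\<in>S. \<integral>x. indicator {s} x * g s \<partial>N)"
    using assms(2) by (intro Bochner_Integration.integral_sum integrable_mult_left integrable_real_indicator)
      (auto simp: less_top[symmetric])
  also have "\<dots> = (\<Sum>s\<in>S. measure N {s} * g s)"
    using assms(2) sp by (intro sum.cong refl) (auto simp: Int_absorb1)
  finally show ?thesis .
qed

theorem theorem2:
  fixes Kbar :: "('i::finite) config set"
    and lam \<mu> \<rho> :: "'i \<Rightarrow> real"
    and \<alpha> :: real
    and r :: "nat \<Rightarrow> real"
    and \<sigma> :: "nat \<Rightarrow> 'i state \<Rightarrow> 'i \<Rightarrow> 'i config"
    and \<Omega> :: "nat \<Rightarrow> 'w measure"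
    and Xinf :: "nat \<Rightarrow> 'w \<Rightarrow> 'i state"
  assumes configs: "config_set Kbar"
    and lam_pos: "\<And>i. lam i > 0"
    and mu_pos: "\<And>i. \<mu> i > 0"
    and rho: "\<And>i. \<rho> i = lam i / \<mu> i"
    and rho_sum: "(\<Sum>i\<in>UNIV. \<rho> i) = 1"
    and alpha_pos: "\<alpha> > 0"
    and r_ge_1: "\<And>n. r n \<ge> 1"
    and r_increasing: "strict_mono r"
    and r_infinity: "filterlim r at_top sequentially"
    and r_integral: "\<And>n i. \<rho> i * r n \<in> \<nat>"
    and greedy: "\<And>n. greedy_rule Kbar \<alpha> (\<sigma> n)"
    and prob: "\<And>n. prob_space (\<Omega> n)"
    and random_state: "\<And>n. Xinf n \<in> measurable (\<Omega> n) (count_space (closed_states Kbar \<rho> (r n)))"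
    and stationary: "\<And>n. stationary_distribution
          (closed_states Kbar \<rho> (r n)) (jump_rate Kbar \<mu> (\<sigma> n))
          (distr (\<Omega> n) (count_space (closed_states Kbar \<rho> (r n))) (Xinf n))"
  shows "\<exists>xstar.
      is_arg_min (fluid_objective Kbar \<alpha>) (\<lambda>x. x \<in> fluid_polyhedron Kbar \<rho>) xstar \<and>
      (\<forall>y. is_arg_min (fluid_objective Kbar \<alpha>) (\<lambda>x. x \<in> fluid_polyhedron Kbar \<rho>) y \<longrightarrow> y = xstar) \<and>
      converges_in_distribution
        (\<lambda>n. distr (\<Omega> n) borel (\<lambda>\<omega>. fluid_scaled (r n) (Xinf n \<omega>)))
        (return borel xstar)"
proof -
  let ?S = "\<lambda>n. closed_states Kbar \<rho> (r n)"
  let ?P = "fluid_polyhedron Kbar \<rho>" and ?F = "fluid_objective Kbar \<alpha>"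
  define N where "N n = distr (\<Omega> n) (count_space (?S n)) (Xinf n)" for n
  define \<Phi> where "\<Phi> n X = dissipation Kbar \<mu> \<alpha> (\<sigma> n) X / r n powr (1 + \<alpha>)" for n X
  define E\<Phi> where "E\<Phi> n = (\<Sum>X\<in>?S n. measure (N n) {X} * \<Phi> n X)" for n
  define M where "M = (\<Sum>i\<in>UNIV. \<mu> i * \<rho> i)"
  have rho_pos: "0 < \<rho> i" for i
    using lam_pos mu_pos by (simp add: rho)
  have rho_le: "\<rho> i \<le> 1" for i
    using member_le_sum[of i UNIV \<rho>] rho_pos by (simp add: rho_sum less_imp_le)
  have rpos: "0 < r n" for n
    using r_ge_1[of n] by linarith
  have M_pos: "0 < M"
    unfolding M_def using mu_pos rho_pos by (intro sum_pos) auto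
  have S: "finite (?S n)" for n
    using rpos[of n] by (intro finite_closed_states[OF configs rho_le]) auto
  have N_prob: "prob_space (N n)" for n
    unfolding N_def using prob random_state by (rule prob_space.prob_space_distr)
  have N_int: "integral\<^sup>L (N n) g = (\<Sum>X\<in>?S n. measure (N n) {X} * g X)" for g :: "'i state \<Rightarrow> real" and n
    using N_prob[of n] S[of n] unfolding prob_space_def
    by (intro integral_finite_count_space) (auto simp: N_def)
  have mass: "(\<Sum>X\<in>?S n. measure (N n) {X}) = 1" for n
    using N_int[of n "\<lambda>_. 1"] prob_space.prob_space[OF N_prob[of n]] by simp

  \<comment> \<open>Vanishing of the mean scaled dissipation\<close>
  have \<Phi>_nonneg: "0 \<le> \<Phi> n X" for n X
    unfolding \<Phi>_def using dissipation_nonneg[OF configs greedy mu_pos] by simp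
  have E\<Phi>_nonneg: "0 \<le> E\<Phi> n" for n
    unfolding E\<Phi>_def using \<Phi>_nonneg by (intro sum_nonneg) auto
  have E\<Phi>_lim: "E\<Phi> \<longlonglongrightarrow> 0"
  proof (rule LIMSEQ_I)
    fix \<epsilon> :: real assume "0 < \<epsilon>"
    \<comment> \<open>Departures occur at total rate \<open>M * r n\<close>, so an error of
      \<open>(\<epsilon> / (2 * M)) * r n powr \<alpha>\<close> for each yields
      \<open>\<epsilon> / 2\<close> after scaling.\<close>
    then have "0 < \<epsilon> / (2 * M)"
      using M_pos by simp
    then obtain R where R: "\<And>r m. R \<le> r \<Longrightarrow> 0 < m \<Longrightarrow> real m \<le> 2 * r \<Longrightarrow>
        real m powr \<alpha> - real (m - 1) powr \<alpha> \<le> (\<epsilon> / (2 * M)) * r powr \<alpha>"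
      using powr_nat_increment_small[OF alpha_pos] by blast
    obtain n0 where n0: "\<And>n. n0 \<le> n \<Longrightarrow> R \<le> r n"
      using r_infinity unfolding filterlim_at_top eventually_sequentially by blast
    have "E\<Phi> n < \<epsilon>" if "n0 \<le> n" for n
    proof -
      have "E\<Phi> n = (\<Sum>X\<in>?S n. measure (N n) {X} * dissipation Kbar \<mu> \<alpha> (\<sigma> n) X) / r n powr (1 + \<alpha>)"
        unfolding E\<Phi>_def \<Phi>_def by (simp add: sum_divide_distrib)
      also have "\<dots> \<le> (\<epsilon> / (2 * M)) * r n powr \<alpha> * M * r n / r n powr (1 + \<alpha>)"
        unfolding M_def
        by (intro divide_right_mono stationary_dissipation_le[OF configs mu_pos alpha_pos rho_le r_ge_1 greedy
              stationary[folded N_def] mass] R[OF n0[OF that], unfolded M_def]) auto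
      also have "\<dots> = \<epsilon> / 2"
        using rpos[of n] M_pos by (simp add: powr_add)
      also have "\<dots> < \<epsilon>"
        using \<open>0 < \<epsilon>\<close> by simp
      finally show ?thesis .
    qed
    then show "\<exists>n0. \<forall>n\<ge>n0. norm (E\<Phi> n - 0) < \<epsilon>"
      using E\<Phi>_nonneg by auto
  qed

  \<comment> \<open>Construction of the minimizer\<close>
  have "\<exists>X\<in>?S n. \<Phi> n X \<le> E\<Phi> n" for n
  proof (rule ccontr)
    assume "\<not> ?thesis"
    then have less: "E\<Phi> n < \<Phi> n X" if "X \<in> ?S n" for X
      using that by auto
    have "\<exists>X\<in>?S n. measure (N n) {X} \<noteq> 0"
      using mass[of n] by (metis (no_types, lifting) sum.neutral zero_neq_one)
    then obtain X0 where X0: "X0 \<in> ?S n" "0 < measure (N n) {X0}"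
      using zero_less_measure_iff by blast
    have "E\<Phi> n = (\<Sum>X\<in>?S n. measure (N n) {X} * E\<Phi> n)"
      using mass[of n] by (simp flip: sum_distrib_right)
    also have "\<dots> < (\<Sum>X\<in>?S n. measure (N n) {X} * \<Phi> n X)"
    proof (rule sum_strict_mono_ex1[OF S])
      show "\<forall>X\<in>?S n. measure (N n) {X} * E\<Phi> n \<le> measure (N n) {X} * \<Phi> n X"
        by (intro ballI mult_left_mono less_imp_le[OF less]) auto
      show "\<exists>X\<in>?S n. measure (N n) {X} * E\<Phi> n < measure (N n) {X} * \<Phi> n X"
        using X0 less by (intro bexI[of _ X0] mult_strict_left_mono)
    qed
    finally show False
      unfolding E\<Phi>_def by simp
  qed
  \<comment> \<open>States not exceeding the mean form a sequence of vanishing scaled dissipation; a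
    limit point of it is the minimizer, whose existence is thereby obtained.\<close>
  then obtain Z where Z: "\<And>n. Z n \<in> ?S n" "\<And>n. \<Phi> n (Z n) \<le> E\<Phi> n"
    by metis
  have "(\<lambda>n. \<Phi> n (Z n)) \<longlonglongrightarrow> 0"
    using \<Phi>_nonneg Z(2) by (intro tendsto_sandwich[OF _ _ tendsto_const E\<Phi>_lim]) auto
  then obtain s0 xstar where "strict_mono s0"
      and "(\<lambda>n. fluid_scaled (r (s0 n)) (Z (s0 n))) \<longlonglongrightarrow> xstar"
      and xstar: "xstar \<in> ?P" "\<And>y. y \<in> ?P \<Longrightarrow> y \<noteq> xstar \<Longrightarrow> ?F xstar < ?F y"
    unfolding \<Phi>_def
    by (rule low_dissipation_subsequence[OF configs mu_pos alpha_pos rho_le r_ge_1 r_infinity greedy Z(1)]) blast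

  \<comment> \<open>Closeness of all states of low dissipation\<close>
  have near: "\<exists>\<delta>>0. \<exists>n0. \<forall>n\<ge>n0. \<forall>X\<in>?S n. \<Phi> n X < \<delta> \<longrightarrow> \<bar>f (fluid_scaled (r n) X) - f xstar\<bar> < \<epsilon>"
    if f: "continuous_on UNIV f" and "0 < \<epsilon>" for f :: "('i config \<Rightarrow> real) \<Rightarrow> real" and \<epsilon>
  proof (rule ccontr)
    assume contra: "\<not> ?thesis"
    have "\<exists>n X. j \<le> n \<and> X \<in> ?S n \<and> \<Phi> n X < inverse (real (Suc j)) \<and>
        \<epsilon> \<le> \<bar>f (fluid_scaled (r n) X) - f xstar\<bar>" for j
    proof -
      have "0 < inverse (real (Suc j))" by simp
      with contra show ?thesis by (meson not_less)
    qed
    \<comment> \<open>The condition \<open>j \<le> n j\<close> makes the chosen parameters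
      \<open>r (n j)\<close> tend to infinity. A limit point of these bad states is again a strict
      minimizer, hence equals \<open>xstar\<close>, which contradicts the separation by
      \<open>\<epsilon>\<close>.\<close>
    then obtain n X where nX: "\<And>j. j \<le> n j" "\<And>j. X j \<in> ?S (n j)"
        "\<And>j. \<Phi> (n j) (X j) < inverse (real (Suc j))"
        "\<And>j. \<epsilon> \<le> \<bar>f (fluid_scaled (r (n j)) (X j)) - f xstar\<bar>"
      by metis
    have "filterlim n sequentially sequentially"
      using nX(1) by (intro filterlim_at_top_mono[OF filterlim_ident]) auto
    then have r_lim: "filterlim (\<lambda>j. r (n j)) at_top sequentially"
      by (rule filterlim_compose[OF r_infinity])
    have "(\<lambda>j. \<Phi> (n j) (X j)) \<longlonglongrightarrow> 0"
      using \<Phi>_nonneg nX(3)[THEN less_imp_le]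
      by (intro tendsto_sandwich[OF _ _ tendsto_const LIMSEQ_inverse_real_of_nat]) auto
    then obtain s x where "strict_mono s"
        and s: "(\<lambda>j. fluid_scaled (r (n (s j))) (X (s j))) \<longlonglongrightarrow> x"
        and x: "x \<in> ?P" "\<And>y. y \<in> ?P \<Longrightarrow> y \<noteq> x \<Longrightarrow> ?F x < ?F y"
      unfolding \<Phi>_def
      by (rule low_dissipation_subsequence[OF configs mu_pos alpha_pos rho_le r_ge_1 r_lim greedy nX(2)]) blast
    have "x = xstar"
      using x(2)[OF xstar(1)] xstar(2)[OF x(1)] by fastforce
    then have "(\<lambda>j. f (fluid_scaled (r (n (s j))) (X (s j)))) \<longlonglongrightarrow> f xstar"
      using s f by (intro continuous_on_tendsto_compose[OF f]) auto
    then have "eventually (\<lambda>j. \<bar>f (fluid_scaled (r (n (s j))) (X (s j))) - f xstar\<bar> < \<epsilon>) sequentially"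
      using \<open>0 < \<epsilon>\<close> unfolding tendsto_iff dist_real_def by blast
    then show False
      using nX(4) by (auto simp: eventually_sequentially not_less[symmetric])
  qed

  \<comment> \<open>Convergence of expectations of bounded continuous functions\<close>
  have "converges_in_distribution
      (\<lambda>n. distr (\<Omega> n) borel (\<lambda>\<omega>. fluid_scaled (r n) (Xinf n \<omega>))) (return borel xstar)"
    unfolding converges_in_distribution_def
  proof (intro allI impI)
    fix f :: "('i config \<Rightarrow> real) \<Rightarrow> real"
    assume f: "continuous_on UNIV f" and "bounded (range f)"
    then obtain B where B: "\<And>x. \<bar>f x\<bar> \<le> B"
      unfolding bounded_iff by auto
    have "0 \<le> B" using B[of xstar] by linarith
    have f_meas: "f \<in> borel_measurable borel"
      by (rule borel_measurable_continuous_onI[OF f])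
    have int: "integral\<^sup>L (distr (\<Omega> n) borel (\<lambda>\<omega>. fluid_scaled (r n) (Xinf n \<omega>))) f =
        (\<Sum>X\<in>?S n. measure (N n) {X} * f (fluid_scaled (r n) X))" for n
    proof -
      have "(\<lambda>\<omega>. fluid_scaled (r n) (Xinf n \<omega>)) \<in> borel_measurable (\<Omega> n)"
        using random_state by (rule measurable_compose) simp
      then have "integral\<^sup>L (distr (\<Omega> n) borel (\<lambda>\<omega>. fluid_scaled (r n) (Xinf n \<omega>))) f =
          (\<integral>\<omega>. f (fluid_scaled (r n) (Xinf n \<omega>)) \<partial>\<Omega> n)"
        using f_meas by (rule integral_distr)
      also have "\<dots> = integral\<^sup>L (N n) (\<lambda>X. f (fluid_scaled (r n) X))"
        unfolding N_def by (rule integral_distr[symmetric, OF random_state]) simp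
      finally show ?thesis
        unfolding N_int .
    qed
    have "(\<lambda>n. \<Sum>X\<in>?S n. measure (N n) {X} * f (fluid_scaled (r n) X)) \<longlonglongrightarrow> f xstar"
    proof (rule LIMSEQ_I)
      fix \<epsilon> :: real assume "0 < \<epsilon>"
      then obtain \<delta> n0 where \<delta>: "0 < \<delta>"
          and n0: "\<And>n X. n0 \<le> n \<Longrightarrow> X \<in> ?S n \<Longrightarrow> \<Phi> n X < \<delta> \<Longrightarrow>
            \<bar>f (fluid_scaled (r n) X) - f xstar\<bar> < \<epsilon> / 2"
        using near[OF f, of "\<epsilon> / 2"] by auto
      have "(\<lambda>n. \<epsilon> / 2 + (2 * B / \<delta>) * E\<Phi> n) \<longlonglongrightarrow> \<epsilon> / 2 + (2 * B / \<delta>) * 0"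
        by (intro tendsto_intros E\<Phi>_lim)
      then have "eventually (\<lambda>n. \<epsilon> / 2 + (2 * B / \<delta>) * E\<Phi> n < \<epsilon>) sequentially"
        by (rule order_tendstoD(2)) (use \<open>0 < \<epsilon>\<close> in simp)
      then obtain n1 where n1: "\<And>n. n1 \<le> n \<Longrightarrow> \<epsilon> / 2 + (2 * B / \<delta>) * E\<Phi> n < \<epsilon>"
        unfolding eventually_sequentially by blast
      have "\<bar>(\<Sum>X\<in>?S n. measure (N n) {X} * f (fluid_scaled (r n) X)) - f xstar\<bar> < \<epsilon>"
        if n: "max n0 n1 \<le> n" for n
      proof -
        \<comment> \<open>Pointwise form of Markov's inequality: the deviation never exceeds
          \<open>2 * B\<close>, and where \<open>\<Phi> n X \<ge> \<delta>\<close> this is at most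
          \<open>2 * B * \<Phi> n X / \<delta>\<close>. Averaging leaves a multiple of
          \<open>E\<Phi> n\<close>.\<close>
        have Markov: "\<bar>f (fluid_scaled (r n) X) - f xstar\<bar> \<le> \<epsilon> / 2 + (2 * B / \<delta>) * \<Phi> n X"
          if X: "X \<in> ?S n" for X
        proof (cases "\<Phi> n X < \<delta>")
          case True
          then have "\<bar>f (fluid_scaled (r n) X) - f xstar\<bar> < \<epsilon> / 2"
            using n0 n X by simp
          moreover have "0 \<le> (2 * B / \<delta>) * \<Phi> n X"
            using \<Phi>_nonneg \<delta> \<open>0 \<le> B\<close> by simp
          ultimately show ?thesis by linarith
        next
          case False
          then have "2 * B * 1 \<le> 2 * B * (\<Phi> n X / \<delta>)"
            using \<delta> \<open>0 \<le> B\<close> by (intro mult_left_mono) auto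
          moreover have "\<bar>f (fluid_scaled (r n) X) - f xstar\<bar> \<le> 2 * B"
            using B[of "fluid_scaled (r n) X"] B[of xstar] by linarith
          ultimately show ?thesis
            using \<open>0 < \<epsilon>\<close> by simp
        qed
        have "(\<Sum>X\<in>?S n. measure (N n) {X} * f (fluid_scaled (r n) X)) - f xstar =
            (\<Sum>X\<in>?S n. measure (N n) {X} * (f (fluid_scaled (r n) X) - f xstar))"
          by (simp add: right_diff_distrib sum_subtractf mass flip: sum_distrib_right)
        also have "\<bar>\<dots>\<bar> \<le> (\<Sum>X\<in>?S n. measure (N n) {X} * (\<epsilon> / 2 + (2 * B / \<delta>) * \<Phi> n X))"
          using Markov by (intro order.trans[OF sum_abs] sum_mono) (auto simp: abs_mult intro: mult_left_mono)
        also have "\<dots> = (\<Sum>X\<in>?S n. measure (N n) {X} * (\<epsilon> / 2)) +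
            (\<Sum>X\<in>?S n. (2 * B / \<delta>) * (measure (N n) {X} * \<Phi> n X))"
          unfolding sum.distrib[symmetric] by (intro sum.cong refl) (simp add: algebra_simps)
        also have "\<dots> = \<epsilon> / 2 + (2 * B / \<delta>) * E\<Phi> n"
          unfolding E\<Phi>_def sum_distrib_left[symmetric] sum_distrib_right[symmetric] mass by simp
        also have "\<dots> < \<epsilon>"
          using n1 n by simp
        finally show ?thesis .
      qed
      then show "\<exists>n0. \<forall>n\<ge>n0. norm ((\<Sum>X\<in>?S n. measure (N n) {X} * f (fluid_scaled (r n) X)) - f xstar) < \<epsilon>"
        unfolding real_norm_def by blast
    qed
    then show "(\<lambda>n. integral\<^sup>L (distr (\<Omega> n) borel (\<lambda>\<omega>. fluid_scaled (r n) (Xinf n \<omega>))) f)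
        \<longlonglongrightarrow> integral\<^sup>L (return borel xstar) f"
      using f_meas by (simp add: int integral_return)
  qed
  moreover have "is_arg_min ?F (\<lambda>x. x \<in> ?P) xstar"
    unfolding is_arg_min_def
  proof (intro conjI notI, rule xstar(1))
    assume "\<exists>y. y \<in> ?P \<and> ?F y < ?F xstar"
    then obtain y where "y \<in> ?P" "?F y < ?F xstar" by blast
    with xstar(2)[of y] show False by force
  qed
  moreover have "y = xstar" if "is_arg_min ?F (\<lambda>x. x \<in> ?P) y" for y
    using xstar that unfolding is_arg_min_def by blast
  ultimately show ?thesis
    by blast
qed

end
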